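(* Let $\lambda>0$, let $B$ be a Brownian motion on $\mathbb{R}$ starting from zero with $\operatorname{Var}B(t)=2t$, and let $U$ be an exponential random variable with parameter $\lambda$, independent of $B$. Then the solution $\psi_{1/2}$ of the fractional relaxation equation $$\frac{d^{1/2}}{dt^{1/2}}\psi(t)=-\lambda\,\psi(t),\quad t>0,\qquad \psi(0)=1,$$ is given by $$\psi_{1/2}(t)=\frac{1}{\sqrt{\pi t}}\int_0^{+\infty}e^{-\lambda y}e^{-\frac{y^2}{4t}}\,dy=\Pr\{|B(t)|<U\}=\Pr\left\{\sup_{0\le s\le t}B(s)<U\right\},\qquad t>0.$$
   Context: $\frac{d^{1/2}}{dt^{1/2}}$ is the Caputo fractional derivative of order $1/2$: $$\frac{d^{1/2}}{dt^{1/2}}u(t)=\frac{1}{\Gamma(1/2)}\int_0^t\frac{1}{(t-s)^{1/2}}\frac{d}{ds}u(s)\,ds .$$ "Exponential with parameter $\lambda$" means density $\lambda e^{-\lambda y}$, $y>0$. *)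

theory Defs
  imports "HOL-Probability.Probability"
begin

definition caputo_half :: "(real \<Rightarrow> real) \<Rightarrow> real \<Rightarrow> real" where
  "caputo_half u t = 1 / Gamma (1/2) * (LBINT s=0..t. 1 / (t - s) powr (1/2) * deriv u s)"

text \<open>
  Only the values on \<open>[0, \<infinity>)\<close> matter. The first three conditions are the regularity under which
  the Caputo derivative is meaningful: \<open>u\<close> has a classical derivative on \<open>(0, \<infinity>)\<close> (possibly
  unbounded at \<open>0\<close>) and the integrand is Lebesgue integrable, so that no default value of
  \<^const>\<open>deriv\<close> or of the integral is ever used. Continuity at \<open>0\<close> ties the initial value to
  the equation.
\<close>
definition solves_half_relaxation :: "real \<Rightarrow> (real \<Rightarrow> real) \<Rightarrow> bool" where
  "solves_half_relaxation l u \<longleftrightarrow>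
     continuous_on {0..} u \<and>
     (\<forall>t>0. u differentiable (at t)) \<and>
     (\<forall>t>0. interval_lebesgue_integrable lborel 0 t (\<lambda>s. 1 / (t - s) powr (1/2) * deriv u s)) \<and>
     (\<forall>t>0. caputo_half u t = - l * u t) \<and>
     u 0 = 1"

text \<open>
  Brownian motion started at \<open>0\<close>, time set \<open>[0, \<infinity>)\<close>, with variance \<open>v * t\<close> at time \<open>t\<close>; the second
  parameter of \<^const>\<open>normal_density\<close> is the standard deviation. Paths are only required to be
  continuous almost surely.
\<close>
definition (in prob_space) brownian_motion :: "real \<Rightarrow> (real \<Rightarrow> 'a \<Rightarrow> real) \<Rightarrow> bool" where
  "brownian_motion v B \<longleftrightarrow>
     (\<forall>t\<ge>0. random_variable borel (B t)) \<and>
     (AE \<omega> in M. B 0 \<omega> = 0) \<and>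
     (\<forall>n (t :: nat \<Rightarrow> real). 0 \<le> t 0 \<and> (\<forall>i<n. t i \<le> t (Suc i)) \<longrightarrow>
        indep_vars (\<lambda>_. borel) (\<lambda>i \<omega>. B (t (Suc i)) \<omega> - B (t i) \<omega>) {..<n}) \<and>
     (\<forall>s t. 0 \<le> s \<and> s < t \<longrightarrow>
        distributed M lborel (\<lambda>\<omega>. B t \<omega> - B s \<omega>) (normal_density 0 (sqrt (v * (t - s))))) \<and>
     (AE \<omega> in M. continuous_on {0..} (\<lambda>t. B t \<omega>))"

lemma (in prob_space) brownian_motion_variance:
  assumes B: "brownian_motion v B" and v: "v > 0" and t: "t \<ge> 0"
  shows "variance (B t) = v * t"
proof -
  have [measurable]: "random_variable borel (B 0)" "random_variable borel (B t)"
    and B0: "AE \<omega> in M. B 0 \<omega> = 0"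
    using B t by (auto simp: brownian_motion_def)
  show ?thesis
  proof (cases "t = 0")
    case True
    have "expectation (B 0) = expectation (\<lambda>_. 0)"
      using B0 by (intro integral_cong_AE) auto
    moreover have "expectation (\<lambda>\<omega>. (B 0 \<omega> - 0)\<^sup>2) = expectation (\<lambda>_. 0)"
      using B0 by (intro integral_cong_AE) auto
    ultimately show ?thesis using True by simp
  next
    case False
    let ?X = "\<lambda>\<omega>. B t \<omega> - B 0 \<omega>"
    have D: "distributed M lborel ?X (normal_density 0 (sqrt (v * t)))"
    proof -
      have "\<forall>s t. 0 \<le> s \<and> s < t \<longrightarrow>
          distributed M lborel (\<lambda>\<omega>. B t \<omega> - B s \<omega>) (normal_density 0 (sqrt (v * (t - s))))"
        using B unfolding brownian_motion_def by blast
      from this[rule_format, of 0 t] show ?thesis using t False by simp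
    qed
    have sd: "0 < sqrt (v * t)" using v t False by simp
    have "expectation (B t) = expectation ?X"
      using B0 by (intro integral_cong_AE) auto
    moreover have "expectation (\<lambda>\<omega>. (B t \<omega> - m)\<^sup>2) = expectation (\<lambda>\<omega>. (?X \<omega> - m)\<^sup>2)" for m
      using B0 by (intro integral_cong_AE) auto
    ultimately have "variance (B t) = variance ?X" by simp
    also have "\<dots> = (sqrt (v * t))\<^sup>2"
      by (rule normal_distributed_variance[OF sd D])
    finally show ?thesis using v t by simp
  qed
qed

end

theory Submission
  imports Defs
begin

text \<open>
  Composing the half-integral with itself gives an ordinary integral. Two applications therefore turn
  the fractional equation into \<open>u' = l\<^sup>2 * u - l / sqrt (pi * t)\<close>, \<open>u 0 = 1\<close>, whose only solution is
  \<open>exp (l\<^sup>2 * t) * erfc (l * sqrt t)\<close>; completing the square identifies it with the stated integral, and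
  conditioning on \<open>B t\<close> identifies that with the probability of \<open>\<bar>B t\<bar> < U\<close>. The running supremum of \<open>B\<close> has the same
  law as \<open>\<bar>B t\<bar>\<close> by the reflection principle, which is obtained without stopping times: for a random walk
  with symmetric increments reflection at the first passage holds up to the overshoot, and the
  overshoot vanishes along refining grids because the paths are uniformly continuous.
\<close>

section \<open>The half-integral\<close>

text \<open>With \<open>A\<close> for \<open>abel\<close> and \<open>c = l / sqrt pi\<close>, the
  fractional equation becomes \<open>(1 + c A) u = 1\<close>, and the differential equation is the
  differentiated form of \<open>(1 - c A) (1 + c A) u = (1 - c A) 1\<close>. Passing to it gives
  uniqueness only. For existence the factor \<open>1 - c A\<close> has to be cancelled, that is,
  \<open>v = c A v\<close> must force \<open>v = 0\<close>; since \<open>(c A)\<^sup>2\<close> is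
  \<open>l\<^sup>2\<close> times integration, this is again uniqueness for a linear differential
  equation. On the probabilistic side the obstacle is measurability. Paths are continuous only
  almost surely, so the supremum need not be a random variable on \<open>M\<close>, and its
  independence of \<open>U\<close> cannot be read off directly. \<open>grid_sup\<close> is a limit
  of maxima over finite grids, hence measurable with respect to the path, and agrees with the
  supremum almost surely. Once it has the law of \<bar>B t\<bar>, the comparison with an independent
  \<open>U\<close> depends on that law alone.\<close>

text \<open>\<open>sqrt pi\<close> times the Riemann--Liouville integral of order \<open>1/2\<close>.\<close>
definition abel :: "(real \<Rightarrow> real) \<Rightarrow> real \<Rightarrow> real" where
  "abel f t = (LBINT s:{0<..<t}. f s / sqrt (t - s))"

text \<open>Rescaling \<open>{r..t}\<close> affinely to \<open>{-1..1}\<close> turns the integrand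
  into the derivative of \<open>arcsin\<close>, whose total increase is \<open>pi\<close>. That the
  value does not depend on \<open>r\<close> and \<open>t\<close> is what makes the iterated
  half-integral a plain integral.\<close>

lemma beta_half_integral:
  fixes r t :: real
  assumes "r < t"
  shows "set_integrable lborel {r<..<t} (\<lambda>s. 1 / (sqrt (t - s) * sqrt (s - r)))"
    and "(LBINT s:{r<..<t}. 1 / (sqrt (t - s) * sqrt (s - r))) = pi"
proof -
  define F where "F s = arcsin ((2 * s - r - t) / (t - r))" for s
  define f where "f s = 1 / (sqrt (t - s) * sqrt (s - r))" for s
  have arg: "-1 < (2 * s - r - t) / (t - r)" "(2 * s - r - t) / (t - r) < 1" if "r < s" "s < t" for s
    using that assms by (auto simp: field_simps)
  have sq: "1 - ((2 * s - r - t) / (t - r))\<^sup>2 = 4 * ((t - s) * (s - r)) / (t - r)\<^sup>2" for s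
  proof -
    have "1 - ((2 * s - r - t) / (t - r))\<^sup>2 = ((t - r)\<^sup>2 - (2 * s - r - t)\<^sup>2) / (t - r)\<^sup>2"
      unfolding power_divide using assms by (simp add: field_simps)
    also have "(t - r)\<^sup>2 - (2 * s - r - t)\<^sup>2 = 4 * ((t - s) * (s - r))" by algebra
    finally show ?thesis .
  qed
  have F: "DERIV F s :> f s" if "ereal r < ereal s" "ereal s < ereal t" for s
  proof -
    have s: "r < s" "s < t" using that by auto
    have "DERIV F s :> inverse (sqrt (1 - ((2 * s - r - t) / (t - r))\<^sup>2)) * (2 / (t - r))"
      unfolding F_def using assms
      by (intro DERIV_chain2[where f = arcsin] DERIV_arcsin DERIV_cdivide arg s)
         (auto intro!: derivative_eq_intros)
    also have "inverse (sqrt (1 - ((2 * s - r - t) / (t - r))\<^sup>2)) * (2 / (t - r)) = f s"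
    proof -
      have root: "sqrt (4 * ((t - s) * (s - r)) / (t - r)\<^sup>2) = 2 * (sqrt (t - s) * sqrt (s - r)) / (t - r)"
        unfolding real_sqrt_divide real_sqrt_mult using s by simp
      have cancel: "inverse (2 * q / d) * (2 / d) = 1 / q" if "0 < d" for q d :: real
        using that by (simp add: inverse_eq_divide)
      show ?thesis
        unfolding sq f_def root by (rule cancel) (use assms in simp)
    qed
    finally show ?thesis .
  qed
  have f: "isCont f s" if "ereal r < ereal s" "ereal s < ereal t" for s
    unfolding f_def using that by (auto intro!: continuous_intros)
  have contF: "continuous_on {r..t} F"
    unfolding F_def using assms by (intro continuous_intros) (auto simp: field_simps)
  have "(F \<longlongrightarrow> F r) (at_right r)" "(F \<longlongrightarrow> F t) (at_left t)"
    using contF assms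
    by (simp_all add: continuous_on_Icc_at_rightD continuous_on_Icc_at_leftD)
  then have lim: "((F \<circ> real_of_ereal) \<longlongrightarrow> F r) (at_right (ereal r))" "((F \<circ> real_of_ereal) \<longlongrightarrow> F t) (at_left (ereal t))"
    by (simp_all add: ereal_tendsto_simps)
  have nonneg: "AE s in lborel. ereal r < ereal s \<longrightarrow> ereal s < ereal t \<longrightarrow> 0 \<le> f s"
    by (auto simp: f_def)
  have "ereal r < ereal t" using assms by simp
  \<comment> \<open>The derivative blows up at both ends; nonnegativity together with the one-sided
    limits of \<open>F\<close> yields integrability along with the value.\<close>
  note FTC = interval_integral_FTC_nonneg[OF this F f nonneg lim]
  have "F t = pi / 2" "F r = - (pi / 2)"
    using assms by (simp_all add: F_def)
       (metis arcsin_1 arcsin_minus_1 diff_gt_0_iff_gt divide_self_if less_irrefl minus_diff_eq minus_divide_left)+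
  show "set_integrable lborel {r<..<t} f"
    using FTC(1) by simp
  show "(LBINT s:{r<..<t}. f s) = pi"
    using FTC(2) assms
    by (simp add: interval_lebesgue_integral_def \<open>F t = pi / 2\<close> \<open>F r = - (pi / 2)\<close>)
qed

lemma abel_one:
  assumes "0 < t"
  shows "set_integrable lborel {0<..<t} (\<lambda>s. 1 / sqrt (t - s))" and "abel (\<lambda>_. 1) t = 2 * sqrt t"
proof -
  define F where "F s = - 2 * sqrt (t - s)" for s
  have F: "DERIV F s :> 1 / sqrt (t - s)" if "ereal 0 < ereal s" "ereal s < ereal t" for s
    unfolding F_def using that by (auto intro!: derivative_eq_intros simp: field_simps)
  have f: "isCont (\<lambda>s. 1 / sqrt (t - s)) s" if "ereal 0 < ereal s" "ereal s < ereal t" for s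
    using that by (auto intro!: continuous_intros)
  have contF: "continuous_on {0..t} F"
    unfolding F_def by (intro continuous_intros)
  have "(F \<longlongrightarrow> F 0) (at_right 0)" "(F \<longlongrightarrow> F t) (at_left t)"
    using contF assms
    by (simp_all add: continuous_on_Icc_at_rightD continuous_on_Icc_at_leftD)
  then have lim: "((F \<circ> real_of_ereal) \<longlongrightarrow> F 0) (at_right (ereal 0))" "((F \<circ> real_of_ereal) \<longlongrightarrow> F t) (at_left (ereal t))"
    by (simp_all add: ereal_tendsto_simps)
  have nonneg: "AE s in lborel. ereal 0 < ereal s \<longrightarrow> ereal s < ereal t \<longrightarrow> 0 \<le> 1 / sqrt (t - s)"
    by auto
  have "ereal 0 < ereal t" using assms by simp
  note FTC = interval_integral_FTC_nonneg[OF this F f nonneg lim]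
  show "set_integrable lborel {0<..<t} (\<lambda>s. 1 / sqrt (t - s))"
    using FTC(1) unfolding einterval_eq .
  show "abel (\<lambda>_. 1) t = 2 * sqrt t"
    using FTC(2) assms unfolding abel_def F_def interval_lebesgue_integral_def einterval_eq by simp
qed

text \<open>Fubini: after exchanging the integrals, the inner one over \<open>{r<..<t}\<close> is
  the Beta integral, equal to \<open>pi\<close> for every \<open>r\<close>.\<close>

lemma abel_abel:
  assumes f: "set_integrable lborel {0<..<t} f"
  shows "set_integrable lborel {0<..<t} (\<lambda>s. abel f s / sqrt (t - s))"
    and "abel (abel f) t = pi * (LBINT s:{0<..<t}. f s)"
proof -
  define g where "g r = indicator {0<..<t} r *\<^sub>R f r" for r
  have g: "integrable lborel g"
    using f by (simp add: set_integrable_def g_def[abs_def])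
  then have [measurable]: "g \<in> borel_measurable borel" by simp
  \<comment> \<open>Both cutoffs are put into the integrands: \<open>k\<close> restricts to
    \<open>r < s < t\<close> and \<open>g\<close> to \<open>0 < r < t\<close>, so the product lives
    on the triangle \<open>0 < r < s < t\<close>.\<close>
  define k where "k r s = indicator {r<..<t} s *\<^sub>R (1 / (sqrt (t - s) * sqrt (s - r)))" for r s
  have k_nonneg: "0 \<le> k r s" for r s
    by (auto simp: k_def indicator_def)
  have k_meas[measurable]: "case_prod k \<in> borel_measurable (borel \<Otimes>\<^sub>M borel)"
    unfolding k_def[abs_def] greaterThanLessThan_iff indicator_def by measurable
  have k: "integrable lborel (k r)" "(LBINT s. k r s) = (if r < t then pi else 0)" for r
  proof -
    show "integrable lborel (k r)"
      using beta_half_integral(1)[of r t] unfolding k_def[abs_def] set_integrable_def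
      by (cases "r < t") auto
    show "(LBINT s. k r s) = (if r < t then pi else 0)"
      using beta_half_integral(2)[of r t] unfolding k_def set_lebesgue_integral_def
      by (cases "r < t") auto
  qed
  have kg: "(LBINT s. k r s) * g r = pi * g r" for r
    by (auto simp: k g_def indicator_def)
  have F: "integrable (lborel \<Otimes>\<^sub>M lborel) (\<lambda>(r, s). k r s * g r)"
  proof (rule lborel_pair.Fubini_integrable)
    have "(LBINT s. norm (k r s * g r)) = pi * norm (g r)" for r
      using k_nonneg[of r] kg[of r] by (simp add: abs_mult k)
    then show "integrable lborel (\<lambda>x. LBINT y. norm (case (x, y) of (r, s) \<Rightarrow> k r s * g r))"
      using g by simp
    show "(\<lambda>(r, s). k r s * g r) \<in> borel_measurable (lborel \<Otimes>\<^sub>M lborel)"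
      by measurable
  qed (auto intro!: integrable_mult_left k)
  have inner: "(LBINT r. k r s * g r) = indicator {0<..<t} s *\<^sub>R (abel f s / sqrt (t - s))" for s
  proof -
    have "(LBINT r. k r s * g r) =
      (LBINT r. indicator {0<..<t} s * (1 / sqrt (t - s)) * (indicator {0<..<s} r * (f r / sqrt (s - r))))"
      by (intro Bochner_Integration.integral_cong) (auto simp: k_def g_def indicator_def)
    also have "\<dots> = indicator {0<..<t} s * (1 / sqrt (t - s)) * (LBINT r. indicator {0<..<s} r * (f r / sqrt (s - r)))"
      by (rule integral_mult_right_zero)
    finally show ?thesis
      by (simp add: abel_def set_lebesgue_integral_def)
  qed
  show "set_integrable lborel {0<..<t} (\<lambda>s. abel f s / sqrt (t - s))"
    using lborel_pair.integrable_snd[OF F] unfolding set_integrable_def inner .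
  have "abel (abel f) t = (LBINT s. LBINT r. k r s * g r)"
    unfolding inner by (simp add: abel_def set_lebesgue_integral_def)
  also have "\<dots> = (LBINT r. LBINT s. k r s * g r)"
    using lborel_pair.Fubini_integral[OF F] by simp
  also have "\<dots> = (LBINT r. pi * g r)"
    using kg by (intro Bochner_Integration.integral_cong) (auto simp: k)
  finally show "abel (abel f) t = pi * (LBINT s:{0<..<t}. f s)"
    by (simp add: g_def set_lebesgue_integral_def)
qed

lemma abel_cong: "(\<And>s. 0 < s \<Longrightarrow> s < t \<Longrightarrow> f s = g s) \<Longrightarrow> abel f t = abel g t"
  unfolding abel_def by (intro set_lebesgue_integral_cong) auto

lemma abel_mult: "abel (\<lambda>s. a * f s) t = a * abel f t"
  by (simp add: abel_def times_divide_eq_right[symmetric] del: times_divide_eq_right)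

lemma abel_diff:
  assumes "set_integrable lborel {0<..<t} (\<lambda>s. f s / sqrt (t - s))"
    and "set_integrable lborel {0<..<t} (\<lambda>s. g s / sqrt (t - s))"
  shows "abel (\<lambda>s. f s - g s) t = abel f t - abel g t"
  using set_integral_diff(2)[OF assms] by (simp add: abel_def diff_divide_distrib)

lemma abel_integrable_continuous:
  assumes t: "0 < t" and f: "continuous_on {0..t} f"
  shows "set_integrable lborel {0<..<t} (\<lambda>s. f s / sqrt (t - s))"
proof -
  have "bounded (f ` {0..t})"
    using f by (intro compact_imp_bounded compact_continuous_image) auto
  then obtain K where "\<forall>x\<in>f ` {0..t}. norm x \<le> K"
    unfolding bounded_iff by blast
  then have K: "\<bar>f s\<bar> \<le> K" if "0 \<le> s" "s \<le> t" for s
    using that by auto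
  have [measurable]: "(\<lambda>s. indicator {0..t} s *\<^sub>R f s) \<in> borel_measurable borel"
    using f by (intro borel_measurable_continuous_on_indicator) auto
  show ?thesis
    unfolding set_integrable_def
  proof (rule Bochner_Integration.integrable_bound)
    show "integrable lborel (\<lambda>s. K * (indicator {0<..<t} s *\<^sub>R (1 / sqrt (t - s))))"
      using abel_one(1)[OF t] unfolding set_integrable_def by (rule integrable_mult_right)
    have "(\<lambda>s. indicator {0<..<t} s *\<^sub>R ((indicator {0..t} s *\<^sub>R f s) / sqrt (t - s))) \<in> borel_measurable lborel"
      by measurable
    also have "(\<lambda>s. indicator {0<..<t} s *\<^sub>R ((indicator {0..t} s *\<^sub>R f s) / sqrt (t - s))) =
        (\<lambda>s. indicator {0<..<t} s *\<^sub>R (f s / sqrt (t - s)))"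
      by (auto simp: indicator_def)
    finally show "(\<lambda>s. indicator {0<..<t} s *\<^sub>R (f s / sqrt (t - s))) \<in> borel_measurable lborel" .
    show "AE s in lborel. norm (indicator {0<..<t} s *\<^sub>R (f s / sqrt (t - s)))
        \<le> norm (K * (indicator {0<..<t} s *\<^sub>R (1 / sqrt (t - s))))"
    proof (intro AE_I2)
      fix s
      have "\<bar>f s\<bar> / sqrt (t - s) \<le> \<bar>K\<bar> / sqrt (t - s)" if "0 < s" "s < t"
        using K[of s] that by (intro divide_right_mono) auto
      then show "norm (indicator {0<..<t} s *\<^sub>R (f s / sqrt (t - s)))
        \<le> norm (K * (indicator {0<..<t} s *\<^sub>R (1 / sqrt (t - s))))"
        by (auto simp: indicator_def abs_mult)
    qed
  qed
qed

text \<open>Multiplying the integrand by \<open>sqrt (t - s)\<close>, which is bounded by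
  \<open>sqrt t\<close>, recovers \<open>f\<close> together with its measurability.\<close>

lemma integrable_of_abel_integrable:
  assumes f: "set_integrable lborel {0<..<t} (\<lambda>s. f s / sqrt (t - s))"
  shows "set_integrable lborel {0<..<t} f"
  unfolding set_integrable_def
proof (rule Bochner_Integration.integrable_bound)
  let ?g = "\<lambda>s. indicator {0<..<t} s *\<^sub>R (f s / sqrt (t - s))"
  show g: "integrable lborel (\<lambda>s. sqrt t * ?g s)"
    using f unfolding set_integrable_def by (rule integrable_mult_right)
  have [measurable]: "?g \<in> borel_measurable borel"
    using f unfolding set_integrable_def by auto
  have "(\<lambda>s. sqrt (t - s) * ?g s) \<in> borel_measurable lborel"
    by measurable
  also have eq: "(\<lambda>s. sqrt (t - s) * ?g s) = (\<lambda>s. indicator {0<..<t} s *\<^sub>R f s)"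
    by (auto simp: indicator_def)
  finally show "(\<lambda>s. indicator {0<..<t} s *\<^sub>R f s) \<in> borel_measurable lborel" .
  show "AE s in lborel. norm (indicator {0<..<t} s *\<^sub>R f s) \<le> norm (sqrt t * ?g s)"
  proof (intro AE_I2)
    fix s
    have "norm (sqrt (t - s) * ?g s) \<le> norm (sqrt t * ?g s)"
    proof (cases "0 < s \<and> s < t")
      case True
      then show ?thesis unfolding norm_mult by (intro mult_right_mono) auto
    qed auto
    then show "norm (indicator {0<..<t} s *\<^sub>R f s) \<le> norm (sqrt t * ?g s)"
      using fun_cong[OF eq, of s] by simp
  qed
qed

text \<open>The fundamental theorem is taken for the gauge integral, which tolerates a derivative
  unbounded near \<open>0\<close>; the assumed Lebesgue integrability then identifies the two
  integrals.\<close>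

lemma set_integral_deriv:
  assumes t: "0 < t" and u: "continuous_on {0..t} u" "\<And>s. 0 < s \<Longrightarrow> s < t \<Longrightarrow> (u has_real_derivative u' s) (at s)"
    and int: "set_integrable lborel {0<..<t} u'"
  shows "(LBINT s:{0<..<t}. u' s) = u t - u 0"
proof -
  have "(u' has_integral u t - u 0) {0..t}"
    using t u(1) u(2)[unfolded has_real_derivative_iff_has_vector_derivative]
    by (intro fundamental_theorem_of_calculus_interior) auto
  then have "integral {0..t} u' = u t - u 0" by (rule integral_unique)
  then show ?thesis
    using set_borel_integral_eq_integral(2)[OF int] by (simp add: integral_open_interval_real)
qed

lemma linear_ode_unique:
  fixes w :: "real \<Rightarrow> real"
  assumes cont: "continuous_on {0..} w" and ode: "\<And>t. 0 < t \<Longrightarrow> (w has_real_derivative k * w t) (at t)"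
    and w0: "w 0 = 0" and t: "0 \<le> t"
  shows "w t = 0"
proof (cases "t = 0")
  case False
  have "exp (- k * t) * w t = exp (- k * 0) * w 0"
  proof (rule DERIV_isconst_end[where f = "\<lambda>t. exp (- k * t) * w t"])
    show "continuous_on {0..t} (\<lambda>t. exp (- k * t) * w t)"
      by (intro continuous_intros continuous_on_subset[OF cont]) auto
    show "((\<lambda>t. exp (- k * t) * w t) has_real_derivative 0) (at x)" if "0 < x" "x < t" for x
      using ode[OF that(1)] by (auto intro!: derivative_eq_intros)
  qed (use t False in auto)
  then show ?thesis using w0 by simp
qed (simp add: w0)

text \<open>Continuity of \<open>u\<close> makes the right-hand side differentiable, so the equation
  improves the regularity of \<open>u\<close>. It serves twice: with \<open>a = 1\<close> and
  \<open>b = l / sqrt pi\<close> for a solution, and with \<open>a = b = 0\<close> for the defect in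
  \<open>abel_relaxation\<close>.\<close>

lemma deriv_of_integral_equation:
  assumes u: "continuous_on {0..} u" and t: "0 < t"
    and eq: "\<And>t. 0 < t \<Longrightarrow> u t = a - 2 * b * sqrt t + k * (LBINT s:{0<..<t}. u s)"
  shows "(u has_real_derivative k * u t - b / sqrt t) (at t)"
proof (rule has_field_derivative_transform_within_open)
  have cont: "continuous_on {0..T} u" for T
    using u by (rule continuous_on_subset) auto
  have "((\<lambda>x. integral {0..x} u) has_real_derivative u t) (at t within {0..t + 1})"
    using t cont by (intro integral_has_real_derivative) auto
  moreover have "at t within {0..t + 1} = at t"
    using t by (intro at_within_interior) auto
  ultimately have [derivative_intros]: "((\<lambda>x. integral {0..x} u) has_real_derivative u t) (at t)"
    by simp
  show "((\<lambda>t. a - 2 * b * sqrt t + k * integral {0..t} u) has_real_derivative k * u t - b / sqrt t) (at t)"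
    using t by (auto intro!: derivative_eq_intros simp: field_simps)
  show "a - 2 * b * sqrt s + k * integral {0..s} u = u s" if "s \<in> {0<..}" for s
  proof -
    have "set_integrable lborel {0<..<s} u"
      using borel_integrable_atLeastAtMost'[OF cont[of s]] by (rule set_integrable_subset) auto
    then have "(LBINT x:{0<..<s}. u x) = integral {0..s} u"
      by (simp add: set_borel_integral_eq_integral(2) integral_open_interval_real)
    then show ?thesis
      using eq[of s] that by simp
  qed
qed (use t in auto)

lemma caputo_half_abel:
  assumes "0 < t"
  shows "caputo_half u t = abel (deriv u) t / sqrt pi"
proof -
  have "(LBINT s=0..t. 1 / (t - s) powr (1/2) * deriv u s) = abel (deriv u) t"
    using assms unfolding abel_def interval_lebesgue_integral_def zero_ereal_def einterval_eq
    by (auto intro!: set_lebesgue_integral_cong simp: powr_half_sqrt)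
  then show ?thesis
    by (simp add: caputo_half_def Gamma_one_half_real)
qed

lemma caputo_integrable_iff:
  assumes "0 < t"
  shows "interval_lebesgue_integrable lborel 0 t (\<lambda>s. 1 / (t - s) powr (1/2) * deriv u s) \<longleftrightarrow>
    set_integrable lborel {0<..<t} (\<lambda>s. deriv u s / sqrt (t - s))"
proof -
  have "set_integrable lborel {0<..<t} (\<lambda>s. 1 / (t - s) powr (1/2) * deriv u s) \<longleftrightarrow>
    set_integrable lborel {0<..<t} (\<lambda>s. deriv u s / sqrt (t - s))"
    by (intro set_integrable_cong) (auto simp: powr_half_sqrt)
  then show ?thesis
    using assms unfolding interval_lebesgue_integrable_def zero_ereal_def einterval_eq by simp
qed

text \<open>Applying the half-integral once to the equation gives \<open>u = 1 - c * abel u\<close> with \<open>c = l / sqrt pi\<close>;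
  applying it a second time removes the singular kernel.\<close>
lemma half_relaxation_ode:
  assumes sol: "solves_half_relaxation l u" and l: "0 < l" and t: "0 < t"
  shows "(u has_real_derivative l\<^sup>2 * u t - l / sqrt pi / sqrt t) (at t)"
proof -
  have cont: "continuous_on {0..} u" and u0: "u 0 = 1"
    and diff: "\<And>t. 0 < t \<Longrightarrow> (u has_real_derivative deriv u t) (at t)"
    and int: "\<And>t. 0 < t \<Longrightarrow> set_integrable lborel {0<..<t} (\<lambda>s. deriv u s / sqrt (t - s))"
    and cap: "\<And>t. 0 < t \<Longrightarrow> abel (deriv u) t = - l * sqrt pi * u t"
  proof -
    show "continuous_on {0..} u" "u 0 = 1"
      using sol by (simp_all add: solves_half_relaxation_def)
    fix t :: real assume t: "0 < t"
    then have *: "u differentiable (at t)" "caputo_half u t = - l * u t"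
      "interval_lebesgue_integrable lborel 0 t (\<lambda>s. 1 / (t - s) powr (1/2) * deriv u s)"
      using sol unfolding solves_half_relaxation_def by blast+
    then show "(u has_real_derivative deriv u t) (at t)"
      by (simp add: DERIV_deriv_iff_real_differentiable)
    show "set_integrable lborel {0<..<t} (\<lambda>s. deriv u s / sqrt (t - s))"
      using *(3) caputo_integrable_iff[OF t] by blast
    show "abel (deriv u) t = - l * sqrt pi * u t"
      using *(2) caputo_half_abel[OF t, of u] by (simp add: field_simps)
  qed
  have contT: "continuous_on {0..T} u" for T
    using cont by (rule continuous_on_subset) auto
  have volterra: "u t = 1 - l / sqrt pi * abel u t" if t: "0 < t" for t
  proof -
    have int': "set_integrable lborel {0<..<t} (deriv u)"
      by (rule integrable_of_abel_integrable[OF int[OF t]])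
    have "pi * (u t - 1) = pi * (LBINT s:{0<..<t}. deriv u s)"
      using set_integral_deriv[OF t contT diff int'] u0 by simp
    also have "\<dots> = abel (abel (deriv u)) t"
      using abel_abel(2)[OF int'] by simp
    also have "\<dots> = abel (\<lambda>s. - l * sqrt pi * u s) t"
      by (intro abel_cong cap)
    also have "\<dots> = - l * sqrt pi * abel u t"
      by (rule abel_mult)
    \<comment> \<open>\<open>pi\<close> is split so that one factor \<open>sqrt pi\<close> cancels,
      leaving the constant \<open>l / sqrt pi\<close>.\<close>
    finally have "sqrt pi * sqrt pi * (u t - 1) = - l * sqrt pi * abel u t"
      by (subst real_sqrt_mult_self) simp
    then have "sqrt pi * (sqrt pi * (u t - 1)) = sqrt pi * (- l * abel u t)"
      by (simp only: mult_ac)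
    then have "sqrt pi * (u t - 1) = - l * abel u t"
      unfolding mult_cancel_left by simp
    then show ?thesis
      by (simp add: field_simps)
  qed
  have "u t = 1 - 2 * (l / sqrt pi) * sqrt t + l\<^sup>2 * (LBINT s:{0<..<t}. u s)" if t: "0 < t" for t
  proof -
    have int: "set_integrable lborel {0<..<t} u"
      by (rule integrable_of_abel_integrable[OF abel_integrable_continuous[OF t contT]])
    \<comment> \<open>\<open>abel\<close> is applied to \<open>l / sqrt pi * abel u = 1 - u\<close>.
      This expresses \<open>abel u\<close> through an ordinary integral, and inserting that into
      \<open>volterra\<close> eliminates it.\<close>
    have "l / sqrt pi * (pi * (LBINT s:{0<..<t}. u s)) = l / sqrt pi * abel (abel u) t"
      using abel_abel(2)[OF int] by simp
    also have "\<dots> = abel (\<lambda>s. l / sqrt pi * abel u s) t"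
      by (rule abel_mult[symmetric])
    also have "\<dots> = abel (\<lambda>s. 1 - u s) t"
      by (intro abel_cong) (use volterra in force)
    also have "\<dots> = 2 * sqrt t - abel u t"
      using abel_one[OF t] abel_integrable_continuous[OF t contT] by (simp add: abel_diff)
    finally have "abel u t = 2 * sqrt t - l / sqrt pi * pi * (LBINT s:{0<..<t}. u s)"
      by simp
    then have "u t = 1 - l / sqrt pi * (2 * sqrt t - l / sqrt pi * pi * (LBINT s:{0<..<t}. u s))"
      using volterra[OF t] by simp
    also have "\<dots> = 1 - 2 * (l / sqrt pi) * sqrt t + (l / sqrt pi * (l / sqrt pi) * pi) * (LBINT s:{0<..<t}. u s)"
      by (simp add: right_diff_distrib)
    also have "l / sqrt pi * (l / sqrt pi) * pi = l\<^sup>2"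
      by (simp add: power2_eq_square)
    finally show ?thesis .
  qed
  then show ?thesis
    by (rule deriv_of_integral_equation[OF cont t])
qed

section \<open>The solution of the relaxation equation\<close>

text \<open>This is \<open>exp (l\<^sup>2 * t) * erfc (l * sqrt t)\<close>, for \<open>t \<ge> 0\<close> only.\<close>
definition relaxation :: "real \<Rightarrow> real \<Rightarrow> real" where
  "relaxation l t = exp (l\<^sup>2 * t) * (1 - 2 / sqrt pi * integral {0..l * sqrt t} (\<lambda>z. exp (- z\<^sup>2)))"

lemma continuous_on_atLeastI:
  fixes f :: "real \<Rightarrow> 'a::topological_space"
  assumes "\<And>b. continuous_on {a..b} f"
  shows "continuous_on {a..} f"
  unfolding continuous_on_eq_continuous_within
proof
  fix x assume x: "x \<in> {a..}"
  have "continuous (at x within {a..x + 1}) f"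
    using assms[of "x + 1"] x by (simp add: continuous_on_eq_continuous_within)
  moreover have "at x within {a..x + 1} = at x within {a..}"
    by (rule at_within_nhd[of _ "{..<x + 1}"]) auto
  ultimately show "continuous (at x within {a..}) f" by simp
qed

lemma relaxation_0: "relaxation l 0 = 1"
  by (simp add: relaxation_def)

lemma continuous_on_relaxation:
  assumes l: "0 < l"
  shows "continuous_on {0..T} (relaxation l)"
proof -
  have "continuous_on {0..l * sqrt T} (\<lambda>x. integral {0..x} (\<lambda>z::real. exp (- z\<^sup>2)))"
    by (intro indefinite_integral_continuous_1 integrable_continuous_real continuous_intros)
  then have "continuous_on {0..T} (\<lambda>t. integral {0..l * sqrt t} (\<lambda>z::real. exp (- z\<^sup>2)))"
    using l by (elim continuous_on_compose2) (auto intro!: continuous_intros)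
  then show ?thesis
    unfolding relaxation_def[abs_def] by (intro continuous_intros)
qed

text \<open>Differentiating the exponential factor gives the linear term. Differentiating the
  Gaussian integral gives \<open>exp (- (l * sqrt t)\<^sup>2)\<close>, which cancels
  \<open>exp (l\<^sup>2 * t)\<close> and leaves only the singular term.\<close>

lemma relaxation_deriv:
  assumes l: "0 < l" and t: "0 < t"
  shows "(relaxation l has_real_derivative l\<^sup>2 * relaxation l t - l / sqrt pi / sqrt t) (at t)"
proof -
  let ?x = "l * sqrt t"
  have "((\<lambda>x. integral {0..x} (\<lambda>z::real. exp (- z\<^sup>2))) has_real_derivative exp (- ?x\<^sup>2)) (at ?x within {0..?x + 1})"
    using l t by (intro integral_has_real_derivative continuous_intros) auto
  moreover have "at ?x within {0..?x + 1} = at ?x"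
    using l t by (intro at_within_interior) auto
  ultimately have "((\<lambda>x. integral {0..x} (\<lambda>z::real. exp (- z\<^sup>2))) has_real_derivative exp (- ?x\<^sup>2)) (at ?x)"
    by simp
  moreover have "((\<lambda>t. l * sqrt t) has_real_derivative l / (2 * sqrt t)) (at t)"
    using t by (auto intro!: derivative_eq_intros simp: field_simps)
  ultimately have 1: "((\<lambda>t. integral {0..l * sqrt t} (\<lambda>z::real. exp (- z\<^sup>2))) has_real_derivative
      exp (- ?x\<^sup>2) * (l / (2 * sqrt t))) (at t)"
    by (rule DERIV_chain2)
  have 2: "((\<lambda>t. exp (l\<^sup>2 * t)) has_real_derivative l\<^sup>2 * exp (l\<^sup>2 * t)) (at t)"
    by (auto intro!: derivative_eq_intros)
  have 3: "((\<lambda>t. 1 - 2 / sqrt pi * integral {0..l * sqrt t} (\<lambda>z::real. exp (- z\<^sup>2))) has_real_derivative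
      - (2 / sqrt pi * (exp (- ?x\<^sup>2) * (l / (2 * sqrt t))))) (at t)"
    using DERIV_diff[OF DERIV_const[of 1] DERIV_cmult[OF 1, of "2 / sqrt pi"]] by simp
  have "- (2 / sqrt pi * (exp (- ?x\<^sup>2) * (l / (2 * sqrt t)))) * exp (l\<^sup>2 * t)
      = - (l / sqrt pi / sqrt t) * (exp (l\<^sup>2 * t) * exp (- ?x\<^sup>2))"
    by simp
  also have "exp (l\<^sup>2 * t) * exp (- ?x\<^sup>2) = 1"
    using t by (simp add: power_mult_distrib flip: exp_add)
  finally have "l\<^sup>2 * exp (l\<^sup>2 * t) * (1 - 2 / sqrt pi * integral {0..?x} (\<lambda>z. exp (- z\<^sup>2))) +
      - (2 / sqrt pi * (exp (- ?x\<^sup>2) * (l / (2 * sqrt t)))) * exp (l\<^sup>2 * t) =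
      l\<^sup>2 * relaxation l t - l / sqrt pi / sqrt t"
    by (simp add: relaxation_def)
  then show ?thesis
    using DERIV_mult[OF 2 3] unfolding relaxation_def[abs_def] by metis
qed

text \<open>The singular term is the same for both functions, so their difference satisfies the
  homogeneous equation and vanishes at \<open>0\<close>.\<close>

lemma half_relaxation_unique:
  assumes sol: "solves_half_relaxation l u" and l: "0 < l" and t: "0 \<le> t"
  shows "u t = relaxation l t"
proof -
  have "u t - relaxation l t = 0"
  proof (rule linear_ode_unique[where w = "\<lambda>t. u t - relaxation l t"])
    have "continuous_on {0..} u" "u 0 = 1"
      using sol by (auto simp: solves_half_relaxation_def)
    moreover have "continuous_on {0..} (relaxation l)"
      by (intro continuous_on_atLeastI continuous_on_relaxation l)
    ultimately show "continuous_on {0..} (\<lambda>t. u t - relaxation l t)" "u 0 - relaxation l 0 = 0"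
      by (auto intro!: continuous_intros simp: relaxation_0)
    show "((\<lambda>t. u t - relaxation l t) has_real_derivative l\<^sup>2 * (u t - relaxation l t)) (at t)" if "0 < t" for t
      using DERIV_diff[OF half_relaxation_ode[OF sol l that] relaxation_deriv[OF l that]]
      by (simp add: right_diff_distrib)
  qed (rule t)
  then show ?thesis by simp
qed

lemma abel_half_power:
  assumes "0 < t"
  shows "set_integrable lborel {0<..<t} (\<lambda>s. 1 / sqrt s / sqrt (t - s))" "abel (\<lambda>s. 1 / sqrt s) t = pi"
  using beta_half_integral[OF assms] by (simp_all add: abel_def field_simps)

text \<open>This leads back from the differential equation to the equation obtained by a single
  half-integration; existence rests on it.\<close>

lemma abel_relaxation:
  assumes l: "0 < l" and t: "0 < t"
  shows "l / sqrt pi * abel (relaxation l) t = 1 - relaxation l t"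
proof -
  define c where "c = l / sqrt pi"
  have c: "0 < c" "c * c * pi = l\<^sup>2"
    using l by (auto simp: c_def power2_eq_square)
  let ?E = "relaxation l"
  note cont = continuous_on_relaxation[OF l]
  have int_E': "set_integrable lborel {0<..<t} (\<lambda>s. ?E s / sqrt (t - s))" if "0 < t" for t
    by (rule abel_integrable_continuous[OF that cont])
  have int_E: "set_integrable lborel {0<..<t} ?E" if "0 < t" for t
    by (rule integrable_of_abel_integrable[OF int_E'[OF that]])
  have E: "l\<^sup>2 * (LBINT s:{0<..<t}. ?E s) = ?E t - 1 + 2 * c * sqrt t" if t: "0 < t" for t
  proof -
    \<comment> \<open>Adding \<open>2 * c * sqrt t\<close> cancels the term
      \<open>c / sqrt t\<close> of the derivative, so the remaining integrand is continuous.\<close>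
    have "(LBINT s:{0<..<t}. l\<^sup>2 * ?E s) = (?E t + 2 * c * sqrt t) - (?E 0 + 2 * c * sqrt 0)"
    proof (rule set_integral_deriv[OF t])
      show "continuous_on {0..t} (\<lambda>t. ?E t + 2 * c * sqrt t)"
        by (intro continuous_intros cont)
      show "((\<lambda>t. ?E t + 2 * c * sqrt t) has_real_derivative l\<^sup>2 * ?E s) (at s)" if "0 < s" for s
        using that by (auto intro!: derivative_eq_intros relaxation_deriv l simp: c_def field_simps)
      show "set_integrable lborel {0<..<t} (\<lambda>s. l\<^sup>2 * ?E s)"
        using int_E[OF t] by simp
    qed
    then show ?thesis by (simp add: relaxation_0)
  qed
  \<comment> \<open>The defect \<open>v\<close> again satisfies \<open>v = c * abel v\<close>, so \<open>v' = l\<^sup>2 * v\<close> and \<open>v 0 = 0\<close>.\<close>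
  define v where "v t = 1 - c * abel ?E t - ?E t" for t
  have int_v': "set_integrable lborel {0<..<t} (\<lambda>s. v s / sqrt (t - s))"
    and v: "c * abel v t = v t" if t: "0 < t" for t
  proof -
    have 1: "set_integrable lborel {0<..<t} (\<lambda>s. (1 - c * abel ?E s) / sqrt (t - s))"
      unfolding diff_divide_distrib times_divide_eq_right[symmetric]
      by (intro set_integral_diff(1) set_integrable_mult_right abel_one abel_abel int_E t)
    show "set_integrable lborel {0<..<t} (\<lambda>s. v s / sqrt (t - s))"
      using set_integral_diff(1)[OF 1 int_E'[OF t]] unfolding v_def by (simp add: diff_divide_distrib)
    have 2: "set_integrable lborel {0<..<t} (\<lambda>s. c * abel ?E s / sqrt (t - s))"
      unfolding times_divide_eq_right[symmetric]
      by (intro set_integrable_mult_right abel_abel int_E t)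
    have "abel v t = 2 * sqrt t - c * (pi * (LBINT s:{0<..<t}. ?E s)) - abel ?E t"
      using abel_diff[OF 1 int_E'[OF t]] abel_diff[OF abel_one(1)[OF t] 2]
      by (simp add: v_def[abs_def] abel_mult abel_one t abel_abel int_E)
    then have "c * abel v t = 2 * c * sqrt t - c * c * pi * (LBINT s:{0<..<t}. ?E s) - c * abel ?E t"
      by (simp only: right_diff_distrib mult_ac)
    also have "\<dots> = v t"
      unfolding c(2) E[OF t] v_def by simp
    finally show "c * abel v t = v t" .
  qed
  have int_v: "set_integrable lborel {0<..<t} v" if "0 < t" for t
    by (rule integrable_of_abel_integrable[OF int_v'[OF that]])
  \<comment> \<open>At \<open>0\<close> the integral in \<open>abel\<close> runs over the empty
    interval and vanishes.\<close>
  have v0: "v 0 = 0"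
    by (simp add: v_def relaxation_0 abel_def set_lebesgue_integral_def)
  have v_eq: "v t = l\<^sup>2 * (LBINT s:{0<..<t}. v s)" if t: "0 < t" for t
  proof -
    have "v t = c * abel (\<lambda>s. c * abel v s) t"
      using v[OF t] abel_cong[of t "\<lambda>s. c * abel v s" v] v by simp
    also have "\<dots> = c * c * pi * (LBINT s:{0<..<t}. v s)"
      by (simp add: abel_mult abel_abel int_v t)
    finally show ?thesis unfolding c(2) .
  qed
  \<comment> \<open>Continuity is read off from \<open>v_eq\<close>, an indefinite integral of an
    integrable function, which avoids a separate study of \<open>abel ?E\<close>.\<close>
  have cont_v: "continuous_on {0..} v"
  proof (rule continuous_on_atLeastI)
    fix T :: real
    show "continuous_on {0..T} v"
    proof (cases "0 < T")
      case True
      have "v integrable_on {0<..<T}"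
        by (rule set_borel_integral_eq_integral(1)[OF int_v[OF True]])
      then have "v integrable_on {0..T}"
        by (simp add: integrable_on_Icc_iff_Ioo)
      then have "continuous_on {0..T} (\<lambda>t. l\<^sup>2 * integral {0..t} v)"
        by (intro continuous_intros indefinite_integral_continuous_1)
      moreover have "l\<^sup>2 * integral {0..t} v = v t" if "t \<in> {0..T}" for t
        using that v_eq[of t] v0 set_borel_integral_eq_integral(2)[OF int_v[of t]]
        by (cases "t = 0") (auto simp: integral_open_interval_real)
      ultimately show ?thesis
        by (rule continuous_on_eq)
    next
      case False
      then have "{0..T} \<subseteq> {0}" by auto
      then show ?thesis by (rule continuous_on_subset[rotated]) simp
    qed
  qed
  have "(v has_real_derivative l\<^sup>2 * v t) (at t)" if "0 < t" for t
    using deriv_of_integral_equation[OF cont_v that, of 0 0 "l\<^sup>2"] v_eq by simp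
  then have "v t = 0"
    using t by (intro linear_ode_unique[where w = v and k = "l\<^sup>2", OF cont_v _ v0]) auto
  then show ?thesis
    by (simp add: v_def c_def)
qed

text \<open>Near \<open>0\<close> the derivative has a singularity of order
  \<open>1 / sqrt s\<close>, which is integrable against the Abel kernel with value
  \<open>pi\<close>. By \<open>abel_relaxation\<close> the term \<open>l * sqrt pi\<close> coming
  from \<open>l\<^sup>2 * abel ?E t\<close> cancels against the one this singularity
  produces.\<close>

lemma relaxation_solves:
  assumes l: "0 < l"
  shows "solves_half_relaxation l (relaxation l)"
proof -
  let ?E = "relaxation l" and ?c = "l / sqrt pi"
  have deriv: "deriv ?E s = l\<^sup>2 * ?E s - ?c * (1 / sqrt s)" if "0 < s" for s
    using DERIV_imp_deriv[OF relaxation_deriv[OF l that]] by simp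
  have int1: "set_integrable lborel {0<..<t} (\<lambda>s. l\<^sup>2 * ?E s / sqrt (t - s))"
    and int2: "set_integrable lborel {0<..<t} (\<lambda>s. ?c * (1 / sqrt s) / sqrt (t - s))" if t: "0 < t" for t
    unfolding times_divide_eq_right[symmetric]
    by (rule set_integrable_mult_right, rule abel_integrable_continuous[OF t continuous_on_relaxation[OF l]])
       (rule set_integrable_mult_right, rule abel_half_power(1)[OF t])
  have int: "set_integrable lborel {0<..<t} (\<lambda>s. deriv ?E s / sqrt (t - s))" if t: "0 < t" for t
  proof -
    have "set_integrable lborel {0<..<t} (\<lambda>s. (l\<^sup>2 * ?E s - ?c * (1 / sqrt s)) / sqrt (t - s))"
      unfolding diff_divide_distrib by (intro set_integral_diff(1) int1 int2 t)
    also have "?this \<longleftrightarrow> ?thesis"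
      by (intro set_integrable_cong) (auto simp: deriv)
    finally show ?thesis .
  qed
  have "abel (deriv ?E) t = - l * sqrt pi * ?E t" if t: "0 < t" for t
  proof -
    have "abel (deriv ?E) t = abel (\<lambda>s. l\<^sup>2 * ?E s - ?c * (1 / sqrt s)) t"
      by (intro abel_cong) (simp add: deriv)
    also have "\<dots> = l\<^sup>2 * abel ?E t - ?c * pi"
      unfolding abel_diff[OF int1[OF t] int2[OF t]] abel_mult abel_half_power(2)[OF t] ..
    also have "l\<^sup>2 * abel ?E t = l * sqrt pi * (?c * abel ?E t)"
      by (simp add: power2_eq_square)
    also have "?c * abel ?E t = 1 - ?E t"
      by (rule abel_relaxation[OF l t])
    also have "?c * pi = l * sqrt pi"
      by (simp add: field_simps)
    finally show ?thesis by (simp add: algebra_simps)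
  qed
  then have "caputo_half ?E t = - l * ?E t" if "0 < t" for t
    using that by (simp add: caputo_half_abel)
  moreover have "?E differentiable (at t)" if "0 < t" for t
    using relaxation_deriv[OF l that] by (auto simp: real_differentiable_def)
  ultimately show ?thesis
    unfolding solves_half_relaxation_def
    using int caputo_integrable_iff continuous_on_atLeastI[OF continuous_on_relaxation[OF l]] relaxation_0
    by blast
qed

section \<open>Gaussian integrals and the probability of \<bar>B(t)\<bar> < U\<close>

lemma has_bochner_integral_gaussian_tail:
  assumes a: "0 \<le> a"
  shows "has_bochner_integral lborel (\<lambda>z. indicator {a<..} z *\<^sub>R exp (- z\<^sup>2))
    (sqrt pi / 2 - integral {0..a} (\<lambda>z. exp (- z\<^sup>2)))"
proof -
  have "set_integrable lborel {0..a} (\<lambda>z::real. exp (- z\<^sup>2))"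
    by (intro borel_integrable_atLeastAtMost' continuous_intros)
  then have "has_bochner_integral lborel (\<lambda>z. indicator {0..a} z *\<^sub>R exp (- z\<^sup>2)) (integral {0..a} (\<lambda>z. exp (- z\<^sup>2)))"
    using set_borel_integral_eq_integral(2)[of "{0..a}" "\<lambda>z::real. exp (- z\<^sup>2)"]
    by (simp add: has_bochner_integral_iff set_integrable_def set_lebesgue_integral_def)
  from has_bochner_integral_diff[OF gaussian_moment_0 this]
  show ?thesis
    by (rule has_bochner_integral_cong[THEN iffD1, rotated 3]) (use a in \<open>auto simp: indicator_def\<close>)
qed

lemma has_bochner_integral_exp_gaussian:
  assumes l: "0 < l" and t: "0 < t"
  shows "has_bochner_integral lborel (\<lambda>y. indicator {0<..} y *\<^sub>R (exp (- l * y) * exp (- y\<^sup>2 / (4 * t))))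
    (sqrt (pi * t) * relaxation l t)"
proof -
  let ?f = "\<lambda>y. indicator {0<..} y *\<^sub>R (exp (- l * y) * exp (- y\<^sup>2 / (4 * t)))"
  let ?I = "integral {0..l * sqrt t} (\<lambda>z. exp (- z\<^sup>2))"
  \<comment> \<open>Complete the square: \<open>l * y + y\<^sup>2 / (4 * t) = z\<^sup>2 - l\<^sup>2 * t\<close> for \<open>z = (y + 2 * l * t) / (2 * sqrt t)\<close>.\<close>
  have shift: "?f (- (2 * l * t) + 2 * sqrt t * z) = exp (l\<^sup>2 * t) * (indicator {l * sqrt t<..} z *\<^sub>R exp (- z\<^sup>2))" for z
  proof -
    define y where "y = - (2 * l * t) + 2 * sqrt t * z"
    have "y = 2 * sqrt t * (z - l * sqrt t)"
      using t by (simp add: y_def algebra_simps)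
    then have pos: "0 < y \<longleftrightarrow> l * sqrt t < z"
      using t by (simp add: zero_less_mult_iff)
    have "(y + 2 * l * t)\<^sup>2 = 4 * t * z\<^sup>2"
      using t by (simp add: y_def power_mult_distrib)
    then have "4 * t * (l * y) + y\<^sup>2 = 4 * t * (z\<^sup>2 - l\<^sup>2 * t)"
      by (simp add: power2_eq_square algebra_simps)
    then have "l * y + y\<^sup>2 / (4 * t) = z\<^sup>2 - l\<^sup>2 * t"
      using t by (simp add: field_simps)
    then have "- l * y + - y\<^sup>2 / (4 * t) = l\<^sup>2 * t + - z\<^sup>2"
      by simp
    then have "exp (- l * y) * exp (- y\<^sup>2 / (4 * t)) = exp (l\<^sup>2 * t) * exp (- z\<^sup>2)"
      unfolding exp_add[symmetric] by simp
    then show ?thesis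
      unfolding y_def[symmetric] using pos by (simp add: indicator_def)
  qed
  have "has_bochner_integral lborel (\<lambda>z. ?f (- (2 * l * t) + 2 * sqrt t * z)) (exp (l\<^sup>2 * t) * (sqrt pi / 2 - ?I))"
    unfolding shift using l t
    by (intro has_bochner_integral_mult_right has_bochner_integral_gaussian_tail) auto
  \<comment> \<open>The Jacobian of the substitution is \<open>2 * sqrt t\<close>, and
    \<open>sqrt (pi * t) / (2 * sqrt t) = sqrt pi / 2\<close> accounts for the normalization of
    \<open>relaxation\<close>.\<close>
  also have "exp (l\<^sup>2 * t) * (sqrt pi / 2 - ?I) = (sqrt (pi * t) * relaxation l t) /\<^sub>R \<bar>2 * sqrt t\<bar>"
    using t by (simp add: relaxation_def real_sqrt_mult field_simps)
  finally show ?thesis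
    using t by (subst lborel_has_bochner_integral_real_affine_iff[where c = "2 * sqrt t" and t = "- (2 * l * t)"]) auto
qed

lemma relaxation_eq_integral:
  assumes l: "0 < l" and t: "0 < t"
  shows "relaxation l t = 1 / sqrt (pi * t) * (LBINT y=0..\<infinity>. exp (- l * y) * exp (- y\<^sup>2 / (4 * t)))"
  using has_bochner_integral_integral_eq[OF has_bochner_integral_exp_gaussian[OF l t]] t
  unfolding interval_lebesgue_integral_0_infty set_lebesgue_integral_def by simp

text \<open>The integrand is even, so this is twice the half-line integral. Standard deviation
  \<open>sqrt (2 * t)\<close> gives the exponent \<open>- y\<^sup>2 / (4 * t)\<close> and the
  prefactor \<open>1 / (2 * sqrt (pi * t))\<close>, and the two factors \<open>2\<close>
  cancel.\<close>

lemma nn_integral_normal_exp_abs: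
  assumes l: "0 < l" and t: "0 < t"
  shows "(\<integral>\<^sup>+ x. ennreal (normal_density 0 (sqrt (2 * t)) x) * ennreal (exp (- l * \<bar>x\<bar>)) \<partial>lborel) = ennreal (relaxation l t)"
proof -
  have "has_bochner_integral lborel (\<lambda>y. indicator {0..} y *\<^sub>R (exp (- l * \<bar>y\<bar>) * exp (- y\<^sup>2 / (4 * t))))
    (sqrt (pi * t) * relaxation l t)"
  proof (rule has_bochner_integral_cong_AE[THEN iffD1, OF _ _ _ has_bochner_integral_exp_gaussian[OF l t]])
    \<comment> \<open>The rule for even functions integrates over the closed half-line; the point
      \<open>0\<close> is a null set.\<close>
    show "AE y in lborel. indicator {0<..} y *\<^sub>R (exp (- l * y) * exp (- y\<^sup>2 / (4 * t))) =
        indicator {0..} y *\<^sub>R (exp (- l * \<bar>y\<bar>) * exp (- y\<^sup>2 / (4 * t)))"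
      using AE_lborel_singleton[of "0::real"] by eventually_elim (auto simp: indicator_def)
  qed auto
  then have "has_bochner_integral lborel (\<lambda>y. exp (- l * \<bar>y\<bar>) * exp (- y\<^sup>2 / (4 * t)))
      (2 *\<^sub>R (sqrt (pi * t) * relaxation l t))"
    by (rule has_bochner_integral_even_function) simp
  then have "has_bochner_integral lborel (\<lambda>y. 1 / (2 * sqrt (pi * t)) * (exp (- l * \<bar>y\<bar>) * exp (- y\<^sup>2 / (4 * t))))
      (1 / (2 * sqrt (pi * t)) * (2 *\<^sub>R (sqrt (pi * t) * relaxation l t)))"
    by (rule has_bochner_integral_mult_right)
  also have "1 / (2 * sqrt (pi * t)) * (2 *\<^sub>R (sqrt (pi * t) * relaxation l t)) = relaxation l t"
    using t by simp
  also have "(\<lambda>y. 1 / (2 * sqrt (pi * t)) * (exp (- l * \<bar>y\<bar>) * exp (- y\<^sup>2 / (4 * t)))) =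
      (\<lambda>y. normal_density 0 (sqrt (2 * t)) y * exp (- l * \<bar>y\<bar>))"
  proof
    fix y
    have "sqrt (2 * pi * (sqrt (2 * t))\<^sup>2) = sqrt (4 * (pi * t))"
      using t by (simp add: mult_ac)
    also have "\<dots> = 2 * sqrt (pi * t)"
      by (simp add: real_sqrt_mult)
    finally show "1 / (2 * sqrt (pi * t)) * (exp (- l * \<bar>y\<bar>) * exp (- y\<^sup>2 / (4 * t))) =
        normal_density 0 (sqrt (2 * t)) y * exp (- l * \<bar>y\<bar>)"
      unfolding normal_density_def using t by simp
  qed
  finally have "has_bochner_integral lborel (\<lambda>y. normal_density 0 (sqrt (2 * t)) y * exp (- l * \<bar>y\<bar>)) (relaxation l t)" .
  then show ?thesis
    by (simp add: has_bochner_integral_iff nn_integral_eq_integral normal_density_nonneg flip: ennreal_mult)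
qed

context prob_space begin

text \<open>The joint law is a product, and the section of the event at \<open>x\<close> is
  \<open>{x<..}\<close>. The right-hand side involves \<open>X\<close> only through its law, which
  is what later lets \<open>grid_sup B t\<close> be exchanged for \<bar>B t\<bar>.\<close>

lemma emeasure_less_indep:
  fixes X Y :: "'a \<Rightarrow> real"
  assumes "indep_var borel X borel Y"
  shows "emeasure M {\<omega> \<in> space M. X \<omega> < Y \<omega>} = (\<integral>\<^sup>+ x. emeasure (distr M borel Y) {x<..} \<partial>distr M borel X)"
proof -
  have [measurable]: "random_variable borel X" "random_variable borel Y"
    and joint: "distr M borel X \<Otimes>\<^sub>M distr M borel Y = distr M (borel \<Otimes>\<^sub>M borel) (\<lambda>\<omega>. (X \<omega>, Y \<omega>))"
    using assms by (auto simp: indep_var_distribution_eq)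
  interpret Y: prob_space "distr M borel Y"
    by (rule prob_space_distr) simp
  have "{p \<in> space (borel \<Otimes>\<^sub>M borel). fst p < (snd p :: real)} \<in> sets (borel \<Otimes>\<^sub>M borel)"
    by measurable
  then have L: "{p :: real \<times> real. fst p < snd p} \<in> sets (borel \<Otimes>\<^sub>M borel)"
    by (simp add: space_pair_measure)
  have "emeasure M {\<omega> \<in> space M. X \<omega> < Y \<omega>} =
      emeasure (distr M (borel \<Otimes>\<^sub>M borel) (\<lambda>\<omega>. (X \<omega>, Y \<omega>))) {p. fst p < snd p}"
    using L by (subst emeasure_distr) (auto intro!: arg_cong2[where f = emeasure])
  also have "\<dots> = (\<integral>\<^sup>+ x. emeasure (distr M borel Y) (Pair x -` {p. fst p < snd p}) \<partial>distr M borel X)"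
    unfolding joint[symmetric] using L by (intro Y.emeasure_pair_measure_alt) simp
  also have "\<dots> = (\<integral>\<^sup>+ x. emeasure (distr M borel Y) {x<..} \<partial>distr M borel X)"
    by (intro nn_integral_cong arg_cong2[where f = emeasure]) auto
  finally show ?thesis .
qed

text \<open>The exponential tail is \<open>exp (- l * x)\<close> for \<open>x \<ge> 0\<close>, so
  conditioning on \<open>X\<close> gives the Laplace transform at \<open>l\<close> of the law of
  \<bar>X\<bar>.\<close>

lemma prob_abs_normal_less_exponential:
  assumes X: "distributed M lborel X (normal_density 0 (sqrt (2 * t)))"
    and U: "distributed M lborel U (exponential_density l)"
    and indep: "indep_var borel (\<lambda>\<omega>. \<bar>X \<omega>\<bar>) borel U"
    and l: "0 < l" and t: "0 < t"
  shows "\<P>(\<omega> in M. \<bar>X \<omega>\<bar> < U \<omega>) = relaxation l t"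
proof -
  have [measurable]: "random_variable borel X" "random_variable borel U"
    using distributed_measurable[OF X] distributed_measurable[OF U] by auto
  have tail: "emeasure (distr M borel U) {x<..} = ennreal (exp (- l * x))" if "0 \<le> x" for x
  proof -
    have "emeasure (distr M borel U) {x<..} = emeasure M {\<omega> \<in> space M. x < U \<omega>}"
      by (subst emeasure_distr) (auto intro!: arg_cong2[where f = emeasure])
    also have "\<dots> = ennreal (exp (- x * l))"
      unfolding emeasure_eq_measure exponential_distributedD_gt[OF U that l] ..
    finally show ?thesis by (simp add: mult.commute)
  qed
  have "emeasure M {\<omega> \<in> space M. \<bar>X \<omega>\<bar> < U \<omega>} = (\<integral>\<^sup>+ x. emeasure (distr M borel U) {x<..} \<partial>distr M borel (\<lambda>\<omega>. \<bar>X \<omega>\<bar>))"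
    by (rule emeasure_less_indep[OF indep])
  also have "\<dots> = (\<integral>\<^sup>+ x. ennreal (exp (- l * x)) \<partial>distr M borel (\<lambda>\<omega>. \<bar>X \<omega>\<bar>))"
  proof (rule nn_integral_cong_AE)
    have "AE x in distr M borel (\<lambda>\<omega>. \<bar>X \<omega>\<bar>). 0 \<le> x"
      by (subst AE_distr_iff) auto
    then show "AE x in distr M borel (\<lambda>\<omega>. \<bar>X \<omega>\<bar>). emeasure (distr M borel U) {x<..} = ennreal (exp (- l * x))"
      by eventually_elim (rule tail)
  qed
  also have "\<dots> = (\<integral>\<^sup>+ \<omega>. ennreal (exp (- l * \<bar>X \<omega>\<bar>)) \<partial>M)"
    by (simp add: nn_integral_distr)
  also have "\<dots> = (\<integral>\<^sup>+ x. ennreal (normal_density 0 (sqrt (2 * t)) x) * ennreal (exp (- l * \<bar>x\<bar>)) \<partial>lborel)"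
    by (rule distributed_nn_integral[OF X, symmetric]) measurable
  also have "\<dots> = ennreal (relaxation l t)"
    by (rule nn_integral_normal_exp_abs[OF l t])
  finally have "ennreal (\<P>(\<omega> in M. \<bar>X \<omega>\<bar> < U \<omega>)) = ennreal (relaxation l t)"
    by (simp add: emeasure_eq_measure)
  \<comment> \<open>\<open>ennreal\<close> sends negative reals to \<open>0\<close>, so it can be
    removed only between nonnegative ones.\<close>
  moreover have "0 \<le> relaxation l t"
    unfolding relaxation_eq_integral[OF l t] interval_lebesgue_integral_0_infty set_lebesgue_integral_def
    using t by (intro mult_nonneg_nonneg integral_nonneg_AE) auto
  ultimately show ?thesis by simp
qed

end

section \<open>The reflection principle\<close>

text \<open>By continuity \<open>f\<close> stays above \<open>a\<close> near \<open>s\<close>, and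
  the mesh \<open>t / real (Suc n)\<close> tends to \<open>0\<close>.\<close>

lemma grid_point_above:
  fixes f :: "real \<Rightarrow> real"
  assumes f: "continuous_on {0..t} f" and t: "0 < t" and s: "s \<in> {0..t}" and a: "a < f s"
  shows "\<forall>\<^sub>F n in sequentially. \<exists>k\<le>Suc n. a < f (t * real k / real (Suc n))"
proof -
  have "0 < f s - a" using a by simp
  then obtain d where d: "0 < d" "\<And>x. x \<in> {0..t} \<Longrightarrow> dist x s < d \<Longrightarrow> dist (f x) (f s) < f s - a"
    using f s unfolding continuous_on_iff by meson
  have "(\<lambda>n. t / real (Suc n)) \<longlonglongrightarrow> 0"
    by real_asymp
  then have "\<forall>\<^sub>F n in sequentially. t / real (Suc n) < d"
    using d(1) by (rule order_tendstoD)
  then show ?thesis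
  proof eventually_elim
    case (elim n)
    define N where "N = real (Suc n)"
    have N: "0 < N" by (simp add: N_def)
    \<comment> \<open>The index of the last grid point not beyond \<open>s\<close>, which lies
      within one mesh width of \<open>s\<close>.\<close>
    define k where "k = nat \<lfloor>s * N / t\<rfloor>"
    have "0 \<le> s * N / t" using s t N by auto
    then have k: "real k \<le> s * N / t" "s * N / t < real k + 1"
      unfolding k_def by linarith+
    have "s * N / t \<le> N"
      using s t N by (simp add: field_simps)
    with k have "k \<le> Suc n" by (simp add: N_def)
    moreover have le: "t * real k / N \<le> s" and gt: "s < t * real k / N + t / N"
      using k t N by (simp_all add: field_simps)
    then have "dist (t * real k / N) s < d"
      using elim by (simp add: N_def dist_real_def)
    moreover have "t * real k / N \<in> {0..t}"
      using le s t N by auto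
    ultimately have "dist (f (t * real k / N)) (f s) < f s - a"
      using d(2) by blast
    then have "a < f (t * real k / N)"
      by (simp add: dist_real_def)
    with \<open>k \<le> Suc n\<close> show ?case by (auto simp: N_def)
  qed
qed

lemma grid_mem:
  fixes t :: real
  assumes "0 < t" "k \<le> Suc n"
  shows "t * real k / real (Suc n) \<in> {0..t}"
proof -
  have "t * real k \<le> t * real (Suc n)"
    using assms by (intro mult_left_mono) auto
  then show ?thesis
    using assms by (simp add: divide_le_eq del: of_nat_Suc)
qed

lemma grid_max_tendsto:
  fixes f :: "real \<Rightarrow> real"
  assumes f: "continuous_on {0..t} f" and t: "0 < t"
  shows "(\<lambda>n. Max ((\<lambda>k. f (t * real k / real (Suc n))) ` {..Suc n})) \<longlonglongrightarrow> (SUP s\<in>{0..t}. f s)"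
proof (rule order_tendstoI)
  have bdd: "bdd_above (f ` {0..t})"
    using f by (intro bounded_imp_bdd_above compact_imp_bounded compact_continuous_image) auto
  fix a
  {
    assume "a < (SUP s\<in>{0..t}. f s)"
    then obtain s where "s \<in> {0..t}" "a < f s"
      using less_cSUP_iff[OF _ bdd] t by auto
    from grid_point_above[OF f t this]
    show "\<forall>\<^sub>F n in sequentially. a < Max ((\<lambda>k. f (t * real k / real (Suc n))) ` {..Suc n})"
      by eventually_elim (subst Max_gr_iff; auto)
  next
    assume a: "(SUP s\<in>{0..t}. f s) < a"
    have "f (t * real k / real (Suc n)) < a" if "k \<le> Suc n" for k n
      using cSUP_upper[OF grid_mem[OF t that] bdd] a by linarith
    then show "\<forall>\<^sub>F n in sequentially. Max ((\<lambda>k. f (t * real k / real (Suc n))) ` {..Suc n}) < a"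
      by (intro always_eventually allI) (subst Max_less_iff; auto)
  }
qed

text \<open>Uniform continuity on the compact interval. Only the upward bound is stated, since only
  upward increments make a walk overshoot.\<close>

lemma grid_increments_small:
  fixes f :: "real \<Rightarrow> real"
  assumes f: "continuous_on {0..t} f" and t: "0 < t" and e: "0 < e"
  shows "\<forall>\<^sub>F n in sequentially.
    \<forall>k<Suc n. f (t * real (Suc k) / real (Suc n)) - f (t * real k / real (Suc n)) \<le> e"
proof -
  obtain d where d: "0 < d" "\<And>x y. x \<in> {0..t} \<Longrightarrow> y \<in> {0..t} \<Longrightarrow> dist y x < d \<Longrightarrow> dist (f y) (f x) < e"
    using compact_uniformly_continuous[OF f] e unfolding uniformly_continuous_on_def by auto
  have "(\<lambda>n. t / real (Suc n)) \<longlonglongrightarrow> 0"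
    by real_asymp
  then have "\<forall>\<^sub>F n in sequentially. t / real (Suc n) < d"
    using d(1) by (rule order_tendstoD)
  then show ?thesis
  proof eventually_elim
    case (elim n)
    show ?case
    proof (intro allI impI)
      fix k assume k: "k < Suc n"
      have "t * (x + 1) / N - t * x / N = t / N" for x N :: real
        by (simp add: distrib_left add_divide_distrib)
      from this[of "real k" "real (Suc n)"]
      have "t * real (Suc k) / real (Suc n) - t * real k / real (Suc n) = t / real (Suc n)"
        by (simp add: add.commute)
      then have "dist (t * real (Suc k) / real (Suc n)) (t * real k / real (Suc n)) < d"
        using elim t by (simp add: dist_real_def)
      then have "dist (f (t * real (Suc k) / real (Suc n))) (f (t * real k / real (Suc n))) < e"
        using k by (intro d(2) grid_mem t) auto
      then show "f (t * real (Suc k) / real (Suc n)) - f (t * real k / real (Suc n)) \<le> e"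
        by (simp add: dist_real_def)
    qed
  qed
qed

context prob_space begin

text \<open>Dominated convergence for indicators: almost surely they eventually equal their
  limit.\<close>

lemma tendsto_prob_AE:
  assumes [measurable]: "\<And>n. A n \<in> events" "A' \<in> events"
    and lim: "AE \<omega> in M. \<forall>\<^sub>F n in sequentially. \<omega> \<in> A n \<longleftrightarrow> \<omega> \<in> A'"
  shows "(\<lambda>n. prob (A n)) \<longlonglongrightarrow> prob A'"
proof -
  have "(\<lambda>n. integral\<^sup>L M (indicat_real (A n))) \<longlonglongrightarrow> integral\<^sup>L M (indicat_real A')"
  proof (rule integral_dominated_convergence[where w = "\<lambda>_. 1"])
    show "AE \<omega> in M. (\<lambda>n. indicat_real (A n) \<omega>) \<longlonglongrightarrow> indicat_real A' \<omega>"
      using lim by eventually_elim (rule tendsto_eventually, auto elim!: eventually_mono simp: indicator_def)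
  qed (auto simp: indicator_def)
  then show ?thesis by simp
qed

lemma prob_symmetric_normal:
  assumes X: "distributed M lborel X (normal_density 0 \<sigma>)" and \<sigma>: "0 < \<sigma>"
  shows "prob {\<omega> \<in> space M. x < X \<omega>} = prob {\<omega> \<in> space M. X \<omega> < - x}"
proof -
  have [measurable]: "random_variable borel X"
    using distributed_measurable[OF X] by auto
  have "distributed M lborel (\<lambda>\<omega>. - X \<omega>) (normal_density 0 \<sigma>)"
    using normal_density_affine[OF X \<sigma>, of "-1" 0] by simp
  then have "distr M lborel (\<lambda>\<omega>. - X \<omega>) = distr M lborel X"
    using X by (simp add: distributed_def)
  then have "measure (distr M lborel X) {x<..} = measure (distr M lborel (\<lambda>\<omega>. - X \<omega>)) {x<..}"
    by simp
  then show ?thesis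
    by (subst (asm) (1 2) measure_distr) (auto simp: vimage_def Int_def conj_commute less_minus_iff)
qed

end

section \<open>Reflection at the first passage of a symmetric walk\<close>

text \<open>Symmetry is required of the block sums from \<open>k\<close> to the end, because exactly
  these are reflected after a first passage at \<open>k\<close>. For a Brownian grid such a block
  telescopes to one Gaussian increment.\<close>

locale symmetric_walk = prob_space M for M :: "'a measure" +
  fixes D :: "nat \<Rightarrow> 'a \<Rightarrow> real" and n :: nat
  assumes indep: "indep_vars (\<lambda>_. borel) D {..<n}"
    and sym: "\<And>k x. k \<le> n \<Longrightarrow> prob {\<omega> \<in> space M. x < (\<Sum>i=k..<n. D i \<omega>)} =
      prob {\<omega> \<in> space M. (\<Sum>i=k..<n. D i \<omega>) < - x}"
begin

definition S :: "nat \<Rightarrow> 'a \<Rightarrow> real" where "S k \<omega> = (\<Sum>i<k. D i \<omega>)"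

text \<open>A predicate on \<open>k\<close> in place of a random time: no value has to be chosen for
  walks that never exceed \<open>a\<close>, and for each \<open>k\<close> only the first
  \<open>k\<close> increments enter.\<close>

definition first_passage :: "real \<Rightarrow> nat \<Rightarrow> 'a \<Rightarrow> bool" where
  "first_passage a k \<omega> \<longleftrightarrow> a < S k \<omega> \<and> (\<forall>j<k. S j \<omega> \<le> a)"

lemma D_measurable [measurable]: "i < n \<Longrightarrow> D i \<in> borel_measurable M"
  using indep by (auto simp: indep_vars_def)

lemma S_measurable [measurable]: "k \<le> n \<Longrightarrow> S k \<in> borel_measurable M"
  unfolding S_def by (intro borel_measurable_sum) auto

lemma first_passage_measurable [measurable]: "k \<le> n \<Longrightarrow> Measurable.pred M (first_passage a k)"
  unfolding first_passage_def by measurable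

lemma S_diff: "k \<le> n \<Longrightarrow> S n \<omega> - S k \<omega> = (\<Sum>i=k..<n. D i \<omega>)"
  unfolding S_def by (simp add: sum_diff_nat_ivl[of 0 k n "\<lambda>i. D i \<omega>", simplified] flip: atLeast0LessThan)

lemma first_passage_ex: "a < S k \<omega> \<Longrightarrow> \<exists>j\<le>k. first_passage a j \<omega>"
  unfolding first_passage_def
  using LeastI[of "\<lambda>k. a < S k \<omega>" k] not_less_Least[of _ "\<lambda>k. a < S k \<omega>"] Least_le[of "\<lambda>k. a < S k \<omega>" k]
  by (metis not_less)

lemma first_passage_unique: "first_passage a j \<omega> \<Longrightarrow> first_passage a k \<omega> \<Longrightarrow> j = k"
  unfolding first_passage_def by (metis linorder_neqE_nat not_less)

text \<open>The first \<open>k\<close> increments decide whether passage happens at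
  \<open>k\<close>, the remaining ones determine \<open>S n \<omega> - S k \<omega>\<close>.
  Independence of these two blocks takes the place of the strong Markov property.\<close>

lemma prob_first_passage_indep:
  assumes k: "k \<le> n" and Q: "Q \<in> sets borel"
  shows "prob {\<omega> \<in> space M. first_passage a k \<omega> \<and> S n \<omega> - S k \<omega> \<in> Q} =
    prob {\<omega> \<in> space M. first_passage a k \<omega>} * prob {\<omega> \<in> space M. (\<Sum>i=k..<n. D i \<omega>) \<in> Q}"
proof -
  let ?P = "\<lambda>K. Pi\<^sub>M K (\<lambda>_. borel :: real measure)" and ?X = "\<lambda>K \<omega>. \<lambda>i\<in>K. D i \<omega>"
  have ind: "indep_var (?P {..<k}) (?X {..<k}) (?P {k..<n}) (?X {k..<n})"
    using k by (intro indep_var_restrict[OF indep]) auto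
  define A where "A = {f \<in> space (?P {..<k}). a < (\<Sum>i<k. f i) \<and> (\<forall>j<k. (\<Sum>i<j. f i) \<le> a)}"
  define C where "C = {f \<in> space (?P {k..<n}). (\<Sum>i=k..<n. f i) \<in> Q}"
  have sum_meas: "(\<lambda>f. \<Sum>i<j. f i) \<in> borel_measurable (?P {..<k})" if "j \<le> k" for j
    using that by (intro borel_measurable_sum measurable_component_singleton) auto
  have A: "A \<in> sets (?P {..<k})"
    unfolding A_def using sum_meas by measurable
  have C: "C \<in> sets (?P {k..<n})"
    unfolding C_def using Q by measurable
  have inA: "?X {..<k} \<omega> \<in> A \<longleftrightarrow> first_passage a k \<omega>" for \<omega>
  proof -
    have "(\<Sum>i<j. ?X {..<k} \<omega> i) = S j \<omega>" if "j \<le> k" for j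
      unfolding S_def using that by (intro sum.cong) auto
    then show ?thesis
      by (auto simp: A_def first_passage_def space_PiM)
  qed
  have inC: "?X {k..<n} \<omega> \<in> C \<longleftrightarrow> (\<Sum>i=k..<n. D i \<omega>) \<in> Q" for \<omega>
    by (auto simp: C_def space_PiM)
  have "prob ((\<lambda>\<omega>. (?X {..<k} \<omega>, ?X {k..<n} \<omega>)) -` (A \<times> C) \<inter> space M) =
      prob (?X {..<k} -` A \<inter> space M) * prob (?X {k..<n} -` C \<inter> space M)"
    by (rule indep_varD[OF ind A C])
  then show ?thesis
    by (simp add: vimage_def inA inC S_diff k Int_def conj_commute)
qed

text \<open>The events for different passage indices are disjoint, and in each summand the second
  factor is unchanged under reflection by \<open>sym\<close>.\<close>

lemma prob_reflection:
  "prob {\<omega> \<in> space M. \<exists>k\<le>n. first_passage a k \<omega> \<and> x < S n \<omega> - S k \<omega>} =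
   prob {\<omega> \<in> space M. \<exists>k\<le>n. first_passage a k \<omega> \<and> S n \<omega> - S k \<omega> < - x}"
proof -
  have split: "prob {\<omega> \<in> space M. \<exists>k\<le>n. first_passage a k \<omega> \<and> S n \<omega> - S k \<omega> \<in> Q} =
      (\<Sum>k\<le>n. prob {\<omega> \<in> space M. first_passage a k \<omega>} * prob {\<omega> \<in> space M. (\<Sum>i=k..<n. D i \<omega>) \<in> Q})"
    if [measurable]: "Q \<in> sets borel" for Q
  proof -
    have "{\<omega> \<in> space M. \<exists>k\<le>n. first_passage a k \<omega> \<and> S n \<omega> - S k \<omega> \<in> Q} =
        (\<Union>k\<in>{..n}. {\<omega> \<in> space M. first_passage a k \<omega> \<and> S n \<omega> - S k \<omega> \<in> Q})"
      by auto
    then have "prob {\<omega> \<in> space M. \<exists>k\<le>n. first_passage a k \<omega> \<and> S n \<omega> - S k \<omega> \<in> Q} =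
        prob (\<Union>k\<in>{..n}. {\<omega> \<in> space M. first_passage a k \<omega> \<and> S n \<omega> - S k \<omega> \<in> Q})"
      by simp
    also have "\<dots> = (\<Sum>k\<le>n. prob {\<omega> \<in> space M. first_passage a k \<omega> \<and> S n \<omega> - S k \<omega> \<in> Q})"
      by (rule finite_measure_finite_Union)
         (auto simp: disjoint_family_on_def dest: first_passage_unique)
    also have "\<dots> = (\<Sum>k\<le>n. prob {\<omega> \<in> space M. first_passage a k \<omega>} * prob {\<omega> \<in> space M. (\<Sum>i=k..<n. D i \<omega>) \<in> Q})"
      by (intro sum.cong prob_first_passage_indep) auto
    finally show ?thesis .
  qed
  show ?thesis
    using split[of "{x<..}"] split[of "{..<- x}"] by (simp add: sym)
qed

text \<open>After passing \<open>a\<close>, a walk that does not end above \<open>a\<close> ends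
  strictly below its passage value. Reflection turns this into ending above the passage value, hence
  above \<open>a\<close>, so each alternative costs at most the probability of
  \<open>a < S n \<omega>\<close>.\<close>

lemma prob_walk_upper:
  "prob {\<omega> \<in> space M. \<exists>k\<le>n. a < S k \<omega>} \<le> 2 * prob {\<omega> \<in> space M. a < S n \<omega>}"
proof -
  have "prob {\<omega> \<in> space M. \<exists>k\<le>n. a < S k \<omega>} \<le>
      prob ({\<omega> \<in> space M. a < S n \<omega>} \<union> {\<omega> \<in> space M. \<exists>k\<le>n. first_passage a k \<omega> \<and> S n \<omega> - S k \<omega> < - 0})"
  proof (rule finite_measure_mono)
    show "{\<omega> \<in> space M. \<exists>k\<le>n. a < S k \<omega>} \<subseteq>
      {\<omega> \<in> space M. a < S n \<omega>} \<union> {\<omega> \<in> space M. \<exists>k\<le>n. first_passage a k \<omega> \<and> S n \<omega> - S k \<omega> < - 0}"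
    proof
      fix \<omega> assume "\<omega> \<in> {\<omega> \<in> space M. \<exists>k\<le>n. a < S k \<omega>}"
      then obtain k where \<omega>: "\<omega> \<in> space M" "k \<le> n" "first_passage a k \<omega>"
        using first_passage_ex by (auto dest: order_trans) (meson order_trans)
      then have "a < S k \<omega>" by (simp add: first_passage_def)
      with \<omega> show "\<omega> \<in> {\<omega> \<in> space M. a < S n \<omega>} \<union> {\<omega> \<in> space M. \<exists>k\<le>n. first_passage a k \<omega> \<and> S n \<omega> - S k \<omega> < - 0}"
        by force
    qed
  qed measurable
  also have "\<dots> \<le> prob {\<omega> \<in> space M. a < S n \<omega>} + prob {\<omega> \<in> space M. \<exists>k\<le>n. first_passage a k \<omega> \<and> S n \<omega> - S k \<omega> < - 0}"
    by (rule measure_Un_le) measurable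
  \<comment> \<open>The form \<open>- 0\<close> is kept so that \<open>prob_reflection\<close>
    applies literally with \<open>x = 0\<close>.\<close>
  also have "prob {\<omega> \<in> space M. \<exists>k\<le>n. first_passage a k \<omega> \<and> S n \<omega> - S k \<omega> < - 0} =
      prob {\<omega> \<in> space M. \<exists>k\<le>n. first_passage a k \<omega> \<and> 0 < S n \<omega> - S k \<omega>}"
    by (rule prob_reflection[symmetric])
  also have "\<dots> \<le> prob {\<omega> \<in> space M. a < S n \<omega>}"
    by (rule finite_measure_mono) (auto simp: first_passage_def)
  finally show ?thesis by simp
qed

text \<open>Unless some increment exceeds \<open>e\<close>, the walk overshoots \<open>a\<close> by at most \<open>e\<close>, so reflecting a path that
  climbs more than \<open>e\<close> after its first passage leads back below \<open>a\<close>.\<close>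
lemma prob_walk_lower:
  assumes a: "0 \<le> a" and e: "0 < e"
  shows "prob {\<omega> \<in> space M. a < S n \<omega>} + prob {\<omega> \<in> space M. a + 2 * e < S n \<omega>} \<le>
    prob {\<omega> \<in> space M. \<exists>k\<le>n. a < S k \<omega>} + 2 * prob {\<omega> \<in> space M. \<exists>k<n. e < D k \<omega>}"
proof -
  define G where "G = {\<omega> \<in> space M. \<exists>k<n. e < D k \<omega>}"
  have [measurable]: "G \<in> events" unfolding G_def by measurable
  have overshoot: "S k \<omega> \<le> a + e" if "\<omega> \<in> space M" "\<omega> \<notin> G" "first_passage a k \<omega>" "k \<le> n" for k \<omega>
  proof (cases k)
    \<comment> \<open>Passage at index \<open>0\<close> is impossible, because
      \<open>S 0 \<omega> = 0\<close> and \<open>0 \<le> a\<close>.\<close>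
    case 0
    then show ?thesis using that a by (simp add: first_passage_def S_def)
  next
    case (Suc j)
    then have "j < n" "S j \<omega> \<le> a"
      using that by (auto simp: first_passage_def)
    moreover have "\<not> e < D j \<omega>"
      using that(1,2) \<open>j < n\<close> unfolding G_def by blast
    ultimately have "S j \<omega> + D j \<omega> \<le> a + e" by simp
    then show ?thesis by (simp add: Suc S_def)
  qed
  let ?up = "{\<omega> \<in> space M. \<exists>k\<le>n. first_passage a k \<omega> \<and> e < S n \<omega> - S k \<omega>}"
  let ?down = "{\<omega> \<in> space M. \<exists>k\<le>n. first_passage a k \<omega> \<and> S n \<omega> - S k \<omega> < - e}"
  let ?max = "{\<omega> \<in> space M. \<exists>k\<le>n. a < S k \<omega>}"
  \<comment> \<open>Of the height \<open>2 * e\<close> above \<open>a\<close>, the overshoot uses at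
    most \<open>e\<close>, so more than \<open>e\<close> is climbed after the passage.\<close>
  have "prob {\<omega> \<in> space M. a + 2 * e < S n \<omega>} \<le> prob (?up \<union> G)"
  proof (rule finite_measure_mono)
    show "{\<omega> \<in> space M. a + 2 * e < S n \<omega>} \<subseteq> ?up \<union> G"
    proof
      fix \<omega> assume \<omega>: "\<omega> \<in> {\<omega> \<in> space M. a + 2 * e < S n \<omega>}"
      then obtain k where "k \<le> n" "first_passage a k \<omega>"
        using first_passage_ex[of a n \<omega>] e by auto
      then show "\<omega> \<in> ?up \<union> G"
        using overshoot[of \<omega> k] \<omega> by force
    qed
  qed measurable
  also have "\<dots> \<le> prob ?up + prob G"
    by (rule measure_Un_le) measurable
  also have "prob ?up = prob ?down"
    by (rule prob_reflection)
  \<comment> \<open>The reflected walk has exceeded \<open>a\<close> but ends below it.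
    \<open>G\<close> is paid for a second time, whence the factor \<open>2\<close>.\<close>
  also have "prob ?down \<le> prob ((?max - {\<omega> \<in> space M. a < S n \<omega>}) \<union> G)"
  proof (rule finite_measure_mono)
    show "?down \<subseteq> (?max - {\<omega> \<in> space M. a < S n \<omega>}) \<union> G"
      using overshoot by (force simp: first_passage_def)
  qed measurable
  also have "\<dots> \<le> prob (?max - {\<omega> \<in> space M. a < S n \<omega>}) + prob G"
    by (rule measure_Un_le) measurable
  also have "prob (?max - {\<omega> \<in> space M. a < S n \<omega>}) = prob ?max - prob {\<omega> \<in> space M. a < S n \<omega>}"
    by (rule finite_measure_Diff) auto
  finally show ?thesis by (simp add: G_def)
qed

end

text \<open>A version of the running supremum that is measurable for the path \<open>\<sigma>\<close>-algebra although the paths are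
  continuous only almost surely; \<^const>\<open>lim\<close> is arbitrary where the limit does not exist.\<close>
definition grid_sup :: "(real \<Rightarrow> 'a \<Rightarrow> real) \<Rightarrow> real \<Rightarrow> 'a \<Rightarrow> real" where
  "grid_sup B t \<omega> = lim (\<lambda>n. Max ((\<lambda>k. B (t * real k / real (Suc n)) \<omega>) ` {..Suc n}))"

lemma grid_sup_eq:
  assumes "continuous_on {0..} (\<lambda>s. B s \<omega>)" and "0 < t"
  shows "grid_sup B t \<omega> = (SUP s\<in>{0..t}. B s \<omega>)"
  unfolding grid_sup_def
  using continuous_on_subset[OF assms(1), of "{0..t}"] assms(2)
  by (intro limI grid_max_tendsto) auto

text \<open>\<open>N\<close> is left general: \<open>M\<close> itself is needed for the law, the
  path \<sigma>-algebra for independence of \<open>U\<close>.\<close>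

lemma grid_sup_measurable:
  assumes "\<And>s. 0 \<le> s \<Longrightarrow> B s \<in> borel_measurable N" and "0 < t"
  shows "grid_sup B t \<in> borel_measurable N"
  unfolding grid_sup_def[abs_def] using assms
  by (intro borel_measurable_lim_metric borel_measurable_Max) auto

section \<open>The law of the supremum of Brownian motion\<close>

context prob_space begin

lemma brownian_motion_normal:
  assumes B: "brownian_motion 2 B" and st: "0 \<le> s" "s < t"
  shows "distributed M lborel (\<lambda>\<omega>. B t \<omega> - B s \<omega>) (normal_density 0 (sqrt (2 * (t - s))))"
  using B[unfolded brownian_motion_def] st by blast

lemma brownian_motion_measurable:
  assumes "brownian_motion 2 B" "0 \<le> t"
  shows "random_variable borel (B t)"
  using assms by (simp add: brownian_motion_def)

lemma brownian_motion_AE: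
  assumes B: "brownian_motion 2 B"
  shows "AE \<omega> in M. continuous_on {0..} (\<lambda>t. B t \<omega>) \<and> B 0 \<omega> = 0"
  using B by (simp add: brownian_motion_def)

lemma brownian_motion_walk:
  assumes B: "brownian_motion 2 B" and t: "0 < t"
  shows "symmetric_walk M (\<lambda>i \<omega>. B (t * real (Suc i) / real (Suc n)) \<omega> - B (t * real i / real (Suc n)) \<omega>) (Suc n)"
    (is "symmetric_walk M ?D _")
proof -
  have mono: "t * real i / real (Suc n) \<le> t * real j / real (Suc n)" if "i \<le> j" for i j
    using that t by (intro divide_right_mono mult_left_mono) auto
  show ?thesis
  proof unfold_locales
    have "\<forall>n (t :: nat \<Rightarrow> real). 0 \<le> t 0 \<and> (\<forall>i<n. t i \<le> t (Suc i)) \<longrightarrow>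
        indep_vars (\<lambda>_. borel) (\<lambda>i \<omega>. B (t (Suc i)) \<omega> - B (t i) \<omega>) {..<n}"
      using B unfolding brownian_motion_def by blast
    from this[THEN spec, of "Suc n", THEN spec, of "\<lambda>i. t * real i / real (Suc n)", THEN mp]
    show "indep_vars (\<lambda>_. borel) ?D {..<Suc n}"
      by (simp only: mono le_SucI order_refl) simp
  next
    fix k :: nat and x :: real assume k: "k \<le> Suc n"
    have sum: "(\<Sum>i=k..<Suc n. ?D i \<omega>) = B t \<omega> - B (t * real k / real (Suc n)) \<omega>" for \<omega>
      using sum_Suc_diff'[OF k, of "\<lambda>i. B (t * real i / real (Suc n)) \<omega>"] by simp
    show "prob {\<omega> \<in> space M. x < (\<Sum>i=k..<Suc n. ?D i \<omega>)} = prob {\<omega> \<in> space M. (\<Sum>i=k..<Suc n. ?D i \<omega>) < - x}"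
    \<comment> \<open>For \<open>k = Suc n\<close> the block is empty and identically
      \<open>0\<close>, so it has no Gaussian density and is treated apart.\<close>
    proof (cases "k = Suc n")
      case False
      then have "t * real k < t * real (Suc n)"
        using k t by (intro mult_strict_left_mono) auto
      then have "t * real k / real (Suc n) < t"
        by (simp add: divide_less_eq del: of_nat_Suc)
      moreover have "0 \<le> t * real k / real (Suc n)"
        using t by simp
      ultimately show ?thesis
        unfolding sum by (intro prob_symmetric_normal[OF brownian_motion_normal[OF B]]) auto
    qed (simp add: sum)
  qed
qed

text \<open>Refining the grid for a fixed \<open>e\<close> turns the two walk bounds into
  \<open>H a + H (a + 2 * e) \<le> P \<le> 2 * H a\<close>, with \<open>H\<close> the upper tail of
  \<open>B t - B 0\<close>. Right-continuity of \<open>H\<close> closes the gap as \<open>e\<close>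
  tends to \<open>0\<close>, and symmetry turns \<open>2 * H a\<close> into the two-sided
  tail.\<close>

lemma prob_grid_sup:
  assumes B: "brownian_motion 2 B" and t: "0 < t" and a: "0 \<le> a"
  shows "prob {\<omega> \<in> space M. a < grid_sup B t \<omega>} = prob {\<omega> \<in> space M. a < \<bar>B t \<omega>\<bar>}"
proof -
  have [measurable]: "random_variable borel (grid_sup B t)"
    using grid_sup_measurable[OF brownian_motion_measurable[OF B] t] .
  have B_grid [measurable]: "random_variable borel (B (t * real k / real (Suc n)))" for k n
    using t by (intro brownian_motion_measurable[OF B]) auto
  have [measurable]: "random_variable borel (B t)" "random_variable borel (B 0)"
    using t by (auto intro!: brownian_motion_measurable[OF B])
  \<comment> \<open>The walk starts at exactly \<open>0\<close>, whereas \<open>B 0\<close> is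
    \<open>0\<close> only almost surely; it is subtracted until the last step.\<close>
  define H where "H b = prob {\<omega> \<in> space M. b < B t \<omega> - B 0 \<omega>}" for b
  define F where "F n = prob {\<omega> \<in> space M. \<exists>k\<le>Suc n. a < B (t * real k / real (Suc n)) \<omega> - B 0 \<omega>}" for n
  define P where "P = prob {\<omega> \<in> space M. a < grid_sup B t \<omega>}"
  define G where "G e n = prob {\<omega> \<in> space M.
    \<exists>k<Suc n. e < B (t * real (Suc k) / real (Suc n)) \<omega> - B (t * real k / real (Suc n)) \<omega>}" for e n
  have upper: "F n \<le> 2 * H a"
    and lower: "0 < e \<Longrightarrow> H a + H (a + 2 * e) \<le> F n + 2 * G e n" for n e
  proof -
    interpret symmetric_walk M "\<lambda>i \<omega>. B (t * real (Suc i) / real (Suc n)) \<omega> - B (t * real i / real (Suc n)) \<omega>" "Suc n"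
      by (rule brownian_motion_walk[OF B t])
    have S: "S k \<omega> = B (t * real k / real (Suc n)) \<omega> - B 0 \<omega>" for k \<omega>
      unfolding S_def by (subst sum_lessThan_telescope) simp
    have end_time: "t * real (Suc n) / real (Suc n) = t"
      by simp
    show "F n \<le> 2 * H a"
      using prob_walk_upper[of a] unfolding F_def H_def S end_time .
    show "H a + H (a + 2 * e) \<le> F n + 2 * G e n" if "0 < e"
      using prob_walk_lower[OF a that] unfolding F_def H_def G_def S end_time .
  qed
  have cont: "continuous_on {0..} f \<Longrightarrow> continuous_on {0..t} f" for f :: "real \<Rightarrow> real"
    by (rule continuous_on_subset) auto
  have F: "F \<longlonglongrightarrow> P"
    unfolding F_def P_def
  proof (rule tendsto_prob_AE)
    show "AE \<omega> in M. \<forall>\<^sub>F n in sequentially.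
      \<omega> \<in> {\<omega> \<in> space M. \<exists>k\<le>Suc n. a < B (t * real k / real (Suc n)) \<omega> - B 0 \<omega>} \<longleftrightarrow>
      \<omega> \<in> {\<omega> \<in> space M. a < grid_sup B t \<omega>}"
      using brownian_motion_AE[OF B]
    proof eventually_elim
      case (elim \<omega>)
      then have c: "continuous_on {0..t} (\<lambda>s. B s \<omega>)" and sup: "grid_sup B t \<omega> = (SUP s\<in>{0..t}. B s \<omega>)"
        using grid_sup_eq t by (auto intro: cont)
      have bdd: "bdd_above ((\<lambda>s. B s \<omega>) ` {0..t})"
        using c by (intro bounded_imp_bdd_above compact_imp_bounded compact_continuous_image) auto
      show ?case
      proof (cases "a < grid_sup B t \<omega>")
        case True
        then obtain s where "s \<in> {0..t}" "a < B s \<omega>"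
          unfolding sup using less_cSUP_iff[OF _ bdd] t by auto
        from grid_point_above[OF c t this] show ?thesis
          by eventually_elim (use True elim in auto)
      next
        case False
        have "B (t * real k / real (Suc n)) \<omega> \<le> a" if "k \<le> Suc n" for k n
          using cSUP_upper[OF grid_mem[OF t that] bdd] False by (simp add: sup)
        then show ?thesis
          using False elim by (intro always_eventually allI) (auto simp: not_less)
      qed
    qed
  qed measurable
  have G: "G e \<longlonglongrightarrow> 0" if e: "0 < e" for e
  proof -
    have "G e \<longlonglongrightarrow> prob {}"
      unfolding G_def
    proof (rule tendsto_prob_AE)
      show "AE \<omega> in M. \<forall>\<^sub>F n in sequentially. \<omega> \<in> {\<omega> \<in> space M.
        \<exists>k<Suc n. e < B (t * real (Suc k) / real (Suc n)) \<omega> - B (t * real k / real (Suc n)) \<omega>} \<longleftrightarrow> \<omega> \<in> {}"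
        using brownian_motion_AE[OF B]
      proof eventually_elim
        case (elim \<omega>)
        from grid_increments_small[OF cont[OF elim[THEN conjunct1]] t e]
        show ?case by eventually_elim (auto simp: not_less)
      qed
    qed measurable
    then show ?thesis by simp
  qed
  have lower_P: "H a + H (a + 2 * e) \<le> P" if e: "0 < e" for e
  proof (rule LIMSEQ_le_const)
    show "(\<lambda>n. F n + 2 * G e n) \<longlonglongrightarrow> P"
      using tendsto_add[OF F tendsto_mult_left[OF G[OF e], of 2]] by simp
  qed (use lower e in auto)
  have "H a + H (a + 2 * (1 / real (Suc m))) \<le> P" for m
    by (rule lower_P) simp
  \<comment> \<open>The strict inequality matters: a path with
    \<open>a < B t \<omega> - B 0 \<omega>\<close> also clears
    \<open>a + 2 * (1 / real (Suc m))\<close> for large \<open>m\<close>.\<close>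
  moreover have "(\<lambda>m. H a + H (a + 2 * (1 / real (Suc m)))) \<longlonglongrightarrow> H a + H a"
    unfolding H_def
  proof (intro tendsto_intros tendsto_prob_AE AE_I2)
    fix \<omega>
    have lim: "(\<lambda>m. a + 2 * (1 / real (Suc m))) \<longlonglongrightarrow> a"
      by real_asymp
    show "\<forall>\<^sub>F m in sequentially.
      \<omega> \<in> {\<omega> \<in> space M. a + 2 * (1 / real (Suc m)) < B t \<omega> - B 0 \<omega>} \<longleftrightarrow>
      \<omega> \<in> {\<omega> \<in> space M. a < B t \<omega> - B 0 \<omega>}"
    proof (cases "a < B t \<omega> - B 0 \<omega>")
      case True
      from order_tendstoD(2)[OF lim this] show ?thesis
        by eventually_elim (use True in auto)
    next
      case False
      have "\<not> a + 2 * (1 / real (Suc m)) < B t \<omega> - B 0 \<omega>" for m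
        using False zero_less_divide_1_iff[of "real (Suc m)"] by linarith
      with False show ?thesis by (intro always_eventually allI) auto
    qed
  qed measurable
  ultimately have "H a + H a \<le> P"
    by (intro LIMSEQ_le_const2) auto
  moreover have "P \<le> 2 * H a"
    using LIMSEQ_le_const2[OF F] upper by auto
  ultimately have "P = H a + H a" by simp
  also have "H a + H a = H a + prob {\<omega> \<in> space M. B t \<omega> - B 0 \<omega> < - a}"
    unfolding H_def using prob_symmetric_normal[OF brownian_motion_normal[OF B order_refl t]] t by simp
  \<comment> \<open>The two tails are disjoint because \<open>0 \<le> a\<close>.\<close>
  also have "\<dots> = prob ({\<omega> \<in> space M. a < B t \<omega> - B 0 \<omega>} \<union> {\<omega> \<in> space M. B t \<omega> - B 0 \<omega> < - a})"
    unfolding H_def using a by (intro finite_measure_Union[symmetric]) auto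
  also have "\<dots> = prob {\<omega> \<in> space M. a < \<bar>B t \<omega>\<bar>}"
  proof (rule measure_eq_AE)
    show "AE \<omega> in M. \<omega> \<in> {\<omega> \<in> space M. a < B t \<omega> - B 0 \<omega>} \<union> {\<omega> \<in> space M. B t \<omega> - B 0 \<omega> < - a} \<longleftrightarrow>
        \<omega> \<in> {\<omega> \<in> space M. a < \<bar>B t \<omega>\<bar>}"
      using brownian_motion_AE[OF B] by eventually_elim (use a in auto)
  qed measurable
  finally show ?thesis unfolding P_def .
qed

text \<open>Distribution functions determine the law. For \<open>a \<ge> 0\<close> they agree by
  complementing the strict tails; for \<open>a < 0\<close> both vanish, since almost surely the
  supremum is at least \<open>B 0 \<omega> = 0\<close>.\<close>

lemma distr_grid_sup:
  assumes B: "brownian_motion 2 B" and t: "0 < t"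
  shows "distr M borel (grid_sup B t) = distr M borel (\<lambda>\<omega>. \<bar>B t \<omega>\<bar>)"
proof -
  have [measurable]: "random_variable borel (grid_sup B t)" "random_variable borel (B t)"
    using grid_sup_measurable[OF brownian_motion_measurable[OF B] t] brownian_motion_measurable[OF B] t by auto
  have cdf: "cdf (distr M borel X) a = prob {\<omega> \<in> space M. X \<omega> \<le> a}" if [measurable]: "random_variable borel X" for X a
    by (subst cdf_def, subst measure_distr) (auto intro!: arg_cong[where f = prob])
  have compl: "prob {\<omega> \<in> space M. X \<omega> \<le> a} = 1 - prob {\<omega> \<in> space M. a < X \<omega>}"
    if [measurable]: "random_variable borel X" for X :: "'a \<Rightarrow> real" and a
    by (subst prob_compl[symmetric]) (auto intro!: arg_cong[where f = prob])
  show ?thesis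
  proof (rule cdf_unique)
    show "cdf (distr M borel (grid_sup B t)) = cdf (distr M borel (\<lambda>\<omega>. \<bar>B t \<omega>\<bar>))"
    proof
      fix a
      show "cdf (distr M borel (grid_sup B t)) a = cdf (distr M borel (\<lambda>\<omega>. \<bar>B t \<omega>\<bar>)) a"
      proof (cases "0 \<le> a")
        case True
        then show ?thesis
          using prob_grid_sup[OF B t] by (simp add: cdf compl)
      next
        case False
        have "prob {\<omega> \<in> space M. grid_sup B t \<omega> \<le> a} = prob {\<omega> \<in> space M. \<bar>B t \<omega>\<bar> \<le> a}"
        proof (rule measure_eq_AE)
          show "AE \<omega> in M. \<omega> \<in> {\<omega> \<in> space M. grid_sup B t \<omega> \<le> a} \<longleftrightarrow> \<omega> \<in> {\<omega> \<in> space M. \<bar>B t \<omega>\<bar> \<le> a}"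
            using brownian_motion_AE[OF B]
          proof eventually_elim
            case (elim \<omega>)
            then have "continuous_on {0..t} (\<lambda>s. B s \<omega>)"
              by (intro continuous_on_subset[of "{0..}" _ "{0..t}"]) auto
            then have "bdd_above ((\<lambda>s. B s \<omega>) ` {0..t})"
              by (intro bounded_imp_bdd_above compact_imp_bounded compact_continuous_image) auto
            then have "B 0 \<omega> \<le> (SUP s\<in>{0..t}. B s \<omega>)"
              using t by (intro cSUP_upper) auto
            then show ?case
              using elim False grid_sup_eq[of B \<omega> t] t by auto
          qed
        qed measurable
        then show ?thesis by (simp add: cdf)
      qed
    qed
  qed (auto intro!: real_distribution_distr)
qed

section \<open>Completion, independence of path functionals, and conclusion\<close>

text \<open>A set almost surely equal to an event differs from it by a null set, hence belongs to
  the completion even when it is not an event of \<open>M\<close>.\<close>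

lemma measure_completion_AE:
  assumes A: "A \<in> events" and A': "A' \<subseteq> space M" and eq: "AE \<omega> in M. \<omega> \<in> A \<longleftrightarrow> \<omega> \<in> A'"
  shows "measure (completion M) A' = prob A"
proof -
  have eq': "AE \<omega> in completion M. \<omega> \<in> A \<longleftrightarrow> \<omega> \<in> A'"
    by (rule AE_completion[OF eq])
  then have "A' \<in> sets (completion M)"
    using A A' by (intro complete_measure.in_sets_AE[OF completion.complete_measure_axioms eq']) auto
  then have "measure (completion M) A' = measure (completion M) A"
    using A eq' by (intro measure_eq_AE) auto
  then show ?thesis using A by simp
qed

text \<open>The events generated by \<open>Y\<close> lie in \<open>N\<close>, so independence of
  \<open>U\<close> from a whole \<sigma>-algebra passes to every function measurable in it. With
  \<open>N\<close> generated by the path this covers \<bar>B t\<bar> and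
  \<open>grid_sup B t\<close>.\<close>

lemma indep_var_vimage_algebra:
  assumes indep: "indep_set (sets (vimage_algebra (space M) U borel)) (sets N)"
    and U: "random_variable borel U" and Y: "Y \<in> measurable N borel" and N: "space N = space M"
  shows "indep_var borel Y borel U"
  unfolding indep_var_eq
proof (intro conjI U indep_setI)
  have sub: "sets N \<subseteq> events"
    using indep by (rule indep_setD_ev2)
  then show "random_variable borel Y"
    using Y N by (auto intro: measurable_from_subalg simp: subalgebra_def)
  have U_sets: "sigma_sets (space M) {U -` A \<inter> space M |A. A \<in> sets borel} = sets (vimage_algebra (space M) U borel)"
    by (simp add: sets_vimage_algebra)
  have Y_sets: "sigma_sets (space M) {Y -` A \<inter> space M |A. A \<in> sets borel} \<subseteq> sets N"
    using Y unfolding N[symmetric] by (intro sets.sigma_sets_subset) (auto intro: measurable_sets)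
  then show "sigma_sets (space M) {Y -` A \<inter> space M |A. A \<in> sets borel} \<subseteq> events"
    using sub by blast
  show "sigma_sets (space M) {U -` A \<inter> space M |A. A \<in> sets borel} \<subseteq> events"
    unfolding U_sets using indep by (rule indep_setD_ev1)
  fix a b
  assume "a \<in> sigma_sets (space M) {Y -` A \<inter> space M |A. A \<in> sets borel}"
    and "b \<in> sigma_sets (space M) {U -` A \<inter> space M |A. A \<in> sets borel}"
  then show "prob (a \<inter> b) = prob a * prob b"
    using indep_setD[OF indep, of b a] Y_sets unfolding U_sets by (auto simp: Int_commute mult.commute)
qed

lemma brownian_motion_distributed:
  assumes B: "brownian_motion 2 B" and t: "0 < t"
  shows "distributed M lborel (B t) (normal_density 0 (sqrt (2 * t)))"
proof -
  have [measurable]: "random_variable borel (B t)" "random_variable borel (B 0)"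
    using t by (auto intro!: brownian_motion_measurable[OF B])
  have "distr M lborel (\<lambda>\<omega>. B t \<omega> - B 0 \<omega>) = distr M lborel (B t)"
    using brownian_motion_AE[OF B] by (intro distr_cong_AE) auto
  then show ?thesis
    using brownian_motion_normal[OF B order_refl t] by (simp add: distributed_def)
qed

end

(* The supremum event lies in the completion of M in general, since paths are only almost surely
   continuous; on events of M the completion has the same probabilities as M. *)
theorem mainTheorem2:
  fixes M :: "'a measure"
    and B :: "real \<Rightarrow> 'a \<Rightarrow> real"
    and U :: "'a \<Rightarrow> real"
    and l :: real
  assumes "prob_space M"
    and "l > 0"
    and "prob_space.brownian_motion M 2 B"
    and "distributed M lborel U (exponential_density l)"
    and "prob_space.indep_set M
           (sets (vimage_algebra (space M) U borel))
           (sets (vimage_algebra (space M) (\<lambda>\<omega>. \<lambda>s\<in>{0..}. B s \<omega>) (Pi\<^sub>M {0..} (\<lambda>_. borel))))"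
  shows "(\<exists>\<psi>. solves_half_relaxation l \<psi>) \<and>
    (\<forall>\<psi>. solves_half_relaxation l \<psi> \<longrightarrow>
      (\<forall>t>0.
        \<psi> t = 1 / sqrt (pi * t) * (LBINT y=0..\<infinity>. exp (- l * y) * exp (- y\<^sup>2 / (4 * t))) \<and>
        \<psi> t = \<P>(\<omega> in M. \<bar>B t \<omega>\<bar> < U \<omega>) \<and>
        \<psi> t = \<P>(\<omega> in completion M. (SUP s\<in>{0..t}. B s \<omega>) < U \<omega>)))"
proof (intro conjI exI allI impI)
  show "solves_half_relaxation l (relaxation l)"
    by (rule relaxation_solves[OF assms(2)])
next
  fix \<psi> t assume \<psi>: "solves_half_relaxation l \<psi>" and t: "0 < (t :: real)"
  have \<psi>_eq: "\<psi> t = relaxation l t"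
    using half_relaxation_unique[OF \<psi> assms(2)] t by simp
  then show "\<psi> t = 1 / sqrt (pi * t) * (LBINT y=0..\<infinity>. exp (- l * y) * exp (- y\<^sup>2 / (4 * t)))"
    using relaxation_eq_integral[OF assms(2) t] by simp
  interpret prob_space M by fact
  let ?path = "\<lambda>\<omega>. \<lambda>s\<in>{0..}. B s \<omega>"
  let ?N = "vimage_algebra (space M) ?path (Pi\<^sub>M {0..} (\<lambda>_. borel))"
  note B = assms(3) and U = assms(4)
  have [measurable]: "random_variable borel U"
    using distributed_measurable[OF U] by simp
  have path: "?path \<in> measurable ?N (Pi\<^sub>M {0..} (\<lambda>_. borel))"
    by (rule measurable_vimage_algebra1) (auto simp: space_PiM)
  have B_N: "B s \<in> borel_measurable ?N" if "0 \<le> s" for s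
    using measurable_compose[OF path measurable_component_singleton[of s "{0..}"]] that by simp
  have abs_N: "(\<lambda>\<omega>. \<bar>B t \<omega>\<bar>) \<in> borel_measurable ?N"
    using B_N[of t] t by simp
  have indep: "indep_var borel (\<lambda>\<omega>. \<bar>B t \<omega>\<bar>) borel U" "indep_var borel (grid_sup B t) borel U"
    using indep_var_vimage_algebra[OF assms(5) _ abs_N]
      indep_var_vimage_algebra[OF assms(5) _ grid_sup_measurable[OF B_N t]] by simp_all
  have abs_less: "\<P>(\<omega> in M. \<bar>B t \<omega>\<bar> < U \<omega>) = relaxation l t"
    by (rule prob_abs_normal_less_exponential[OF brownian_motion_distributed[OF B t] U indep(1) assms(2) t])
  then show "\<psi> t = \<P>(\<omega> in M. \<bar>B t \<omega>\<bar> < U \<omega>)"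
    using \<psi>_eq by simp
  have [measurable]: "random_variable borel (grid_sup B t)"
    by (rule grid_sup_measurable[OF brownian_motion_measurable[OF B] t])
  \<comment> \<open>Where the path is continuous the supremum equals \<open>grid_sup\<close>, so the
    two events differ by a null set.\<close>
  have "\<P>(\<omega> in completion M. (SUP s\<in>{0..t}. B s \<omega>) < U \<omega>) = \<P>(\<omega> in M. grid_sup B t \<omega> < U \<omega>)"
  proof (rule measure_completion_AE)
    show "AE \<omega> in M. \<omega> \<in> {\<omega> \<in> space M. grid_sup B t \<omega> < U \<omega>} \<longleftrightarrow>
        \<omega> \<in> {\<omega> \<in> space (completion M). (SUP s\<in>{0..t}. B s \<omega>) < U \<omega>}"
      using brownian_motion_AE[OF B] by eventually_elim (auto simp: grid_sup_eq[OF _ t])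
  qed auto
  \<comment> \<open>\<open>U\<close> is independent of either variable and the two laws agree, so
    both probabilities are the same integral.\<close>
  also have "\<dots> = \<P>(\<omega> in M. \<bar>B t \<omega>\<bar> < U \<omega>)"
    unfolding measure_def emeasure_less_indep[OF indep(1)] emeasure_less_indep[OF indep(2)]
      distr_grid_sup[OF B t] ..
  finally show "\<psi> t = \<P>(\<omega> in completion M. (SUP s\<in>{0..t}. B s \<omega>) < U \<omega>)"
    using \<psi>_eq abs_less by simp
qed

end
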